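(* Let $(X,\mathfrak B,\mu)$ be a standard non-atomic $\sigma$-finite measure space with $\mu(X)=\infty$. If $T\in\mathrm{Aut}_1(X,\mu)$ and $\chi(T)\neq0$, then the Poisson suspension $T_*$ of $T$ is totally dissipative on $(X^*,\mu^* )$.
   Context: $\mathrm{Aut}(X,\mu)$ is the group of all invertible $\mu$-nonsingular transformations of $X$ (mod null sets). For $T\in\mathrm{Aut}(X,\mu)$ put $T'=\frac{d\mu\circ T^{-1}}{d\mu}$; $\mathrm{Aut}_1(X,\mu)=\{T\in\mathrm{Aut}(X,\mu):T'-1\in L^1(X,\mu)\}$ and $\chi(T)=\int_X(T'-1)\,d\mu$ for $T\in\mathrm{Aut}_1(X,\mu)$. Poisson suspension: $X^*$ is the space of $\mathbb Z_+\cup\{\infty\}$-valued point (counting) measures $\omega$ on $X$ with the $\sigma$-algebra generated by the maps $\omega\mapsto\omega(A)$, $A\in\mathfrak B$; $\mu^*$ is the probability on $X^*$ (the law of the Poisson point process of intensity $\mu$) such that for each $A$ with $\mu(A)<\infty$ the variable $\omega\mapsto\omega(A)$ is Poisson with parameter $\mu(A)$, and for disjoint sets these variables are independent; $T_*\omega=\omega\circ T^{-1}$. For $T\in\mathrm{Aut}_1(X,\mu)$, $T_*$ is an invertible nonsingular transformation of $(X^*,\mu^* )$. An invertible nonsingular transformation $S$ of $(Y,\nu)$ is totally dissipative if there is a measurable $B\subset Y$ such that the sets $S^nB$, $n\in\mathbb Z$, are pairwise disjoint and their union is $Y$ (mod 0). *)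

theory Defs
  imports "HOL-Probability.Probability"
begin

section \<open>Standard non-atomic measure spaces\<close>

definition standard_borel :: "'a measure \<Rightarrow> bool" where
  "standard_borel M \<longleftrightarrow>
     (\<exists>X. completely_metrizable_space X \<and> second_countable X \<and> topspace X = space M \<and>
          sets M = sigma_sets (space M) {U. openin X U})"

definition is_atom :: "'a measure \<Rightarrow> 'a set \<Rightarrow> bool" where
  "is_atom M A \<longleftrightarrow> A \<in> sets M \<and> emeasure M A > 0 \<and>
     (\<forall>B\<in>sets M. B \<subseteq> A \<longrightarrow> emeasure M B = 0 \<or> emeasure M (A - B) = 0)"

definition non_atomic :: "'a measure \<Rightarrow> bool" where
  "non_atomic M \<longleftrightarrow> (\<nexists>A. is_atom M A)"


section \<open>Invertible nonsingular transformations\<close>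

text \<open>Elements of Aut are classes of maps modulo null sets. A map represents such a class if it is
  measurable, has a measurable inverse almost everywhere, and transports the measure to an
  equivalent one.\<close>

definition inverse_mod0 :: "'a measure \<Rightarrow> ('a \<Rightarrow> 'a) \<Rightarrow> ('a \<Rightarrow> 'a) \<Rightarrow> bool" where
  "inverse_mod0 M T R \<longleftrightarrow> R \<in> M \<rightarrow>\<^sub>M M \<and> (AE x in M. R (T x) = x) \<and> (AE x in M. T (R x) = x)"

definition Aut :: "'a measure \<Rightarrow> ('a \<Rightarrow> 'a) set" where
  "Aut M = {T \<in> M \<rightarrow>\<^sub>M M. (\<exists>R. inverse_mod0 M T R) \<and> null_sets (distr M M T) = null_sets M}"

text \<open>\<open>nonsing_deriv M T\<close> is the Radon-Nikodym derivative of the image measure of \<open>M\<close> under \<open>T\<close>. For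
  \<open>T \<in> Aut M\<close> with \<open>M\<close> sigma-finite, it is finite almost everywhere, so passing to real values
  changes it only on a null set.\<close>

definition nonsing_deriv :: "'a measure \<Rightarrow> ('a \<Rightarrow> 'a) \<Rightarrow> 'a \<Rightarrow> real" where
  "nonsing_deriv M T x = enn2real (RN_deriv M (distr M M T) x)"

definition Aut1 :: "'a measure \<Rightarrow> ('a \<Rightarrow> 'a) set" where
  "Aut1 M = {T \<in> Aut M. integrable M (\<lambda>x. nonsing_deriv M T x - 1)}"

definition chi :: "'a measure \<Rightarrow> ('a \<Rightarrow> 'a) \<Rightarrow> real" where
  "chi M T = (\<integral>x. (nonsing_deriv M T x - 1) \<partial>M)"

text \<open>The set \<open>S\<^sup>n B\<close> is the preimage of \<open>B\<close> under the \<open>n\<close>-th power of the inverse \<open>R\<close> if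
  \<open>n \<ge> 0\<close>, and under the \<open>-n\<close>-th power of \<open>S\<close> otherwise: preimages are measurable and do not
  depend, modulo null sets, on the choice of \<open>R\<close>, whereas forward images under a map that is
  invertible only almost everywhere need not be.\<close>

definition power_image :: "'a measure \<Rightarrow> ('a \<Rightarrow> 'a) \<Rightarrow> ('a \<Rightarrow> 'a) \<Rightarrow> int \<Rightarrow> 'a set \<Rightarrow> 'a set" where
  "power_image N S R n B =
     (if n \<ge> 0 then (R ^^ nat n) -` B \<inter> space N else (S ^^ nat (- n)) -` B \<inter> space N)"

definition totally_dissipative :: "'a measure \<Rightarrow> ('a \<Rightarrow> 'a) \<Rightarrow> bool" where
  "totally_dissipative N S \<longleftrightarrow> S \<in> Aut N \<and>
     (\<exists>R B. inverse_mod0 N S R \<and> B \<in> sets N \<and>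
        (\<forall>m n. m \<noteq> n \<longrightarrow> power_image N S R m B \<inter> power_image N S R n B \<in> null_sets N) \<and>
        space N - (\<Union>n. power_image N S R n B) \<in> null_sets N)"


section \<open>Poisson suspensions\<close>

text \<open>The sigma-algebra is generated by the evaluations at measurable sets, as in
  \<^const>\<open>subprob_algebra\<close>.\<close>

definition point_measures :: "'a measure \<Rightarrow> 'a measure measure" where
  "point_measures M =
     (SUP A \<in> sets M. vimage_algebra
        {w. sets w = sets M \<and> (\<forall>C\<in>sets M. emeasure w C \<in> insert \<infinity> (range of_nat))}
        (\<lambda>w. emeasure w A) borel)"

text \<open>The Poisson probabilities are written out since \<^const>\<open>poisson_pmf\<close> requires a
  positive rate, while null sets have rate \<open>0\<close>.\<close>

definition poisson_law :: "'a measure \<Rightarrow> 'a measure measure \<Rightarrow> bool" where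
  "poisson_law M P \<longleftrightarrow> prob_space P \<and> sets P = sets (point_measures M) \<and>
     (\<forall>A\<in>sets M. emeasure M A < \<infinity> \<longrightarrow>
        (\<forall>k::nat. measure P {w \<in> space P. emeasure w A = of_nat k} =
           measure M A ^ k / fact k * exp (- measure M A))) \<and>
     (\<forall>A::nat \<Rightarrow> 'a set. disjoint_family A \<longrightarrow>
        (\<forall>i. A i \<in> sets M \<and> emeasure M (A i) < \<infinity>) \<longrightarrow>
        prob_space.indep_vars P (\<lambda>_. borel) (\<lambda>i w. emeasure w (A i)) UNIV)"

definition suspension :: "'a measure \<Rightarrow> ('a \<Rightarrow> 'a) \<Rightarrow> 'a measure \<Rightarrow> 'a measure" where
  "suspension M T w = distr w M T"

end

theory Submission
  imports Defs
begin

text \<open>Write \<open>S\<close> for the suspension and \<open>F n\<close> for the density of the image of \<open>M\<close> under \<open>T\<^sup>n\<close>. The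
  integral of \<open>F n - 1\<close> is \<open>n \<cdot> \<chi>(T)\<close>, whereas the integral of \<open>F n - 1\<close> clamped to \<open>[-\<epsilon>, \<epsilon>]\<close> is at most
  \<open>n \<cdot> \<delta>(\<epsilon>)\<close> with \<open>\<delta>(\<epsilon>) \<rightarrow> 0\<close>. Hence there are \<open>\<epsilon>, c > 0\<close> and, for every \<open>n\<close>, a set \<open>D\<close> such that one of
  \<open>M(D)\<close> and \<open>M(T\<^sup>-\<^sup>n D)\<close> exceeds \<open>1 + \<epsilon>\<close> times the other by \<open>c n\<close>. The number of points in \<open>D\<close> then
  distinguishes \<open>P\<close> from its image under \<open>S\<^sup>n\<close> up to an exponentially small error, and a
  Borel-Cantelli argument yields sets that exhaust the space and are not revisited after boundedly
  many steps. Nonsingularity of \<open>S\<close> is proved by comparing the two Poisson laws on events that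
  depend on finitely many counts, with bounds independent of these events.\<close>


section \<open>Wandering sets from separating events\<close>

text \<open>A gap of order \<open>n\<close> between the expected counts does not separate the laws
  by itself: a Poisson count of mean \<open>a\<close> fluctuates by about the square root of
  \<open>a\<close>, and the integral of \<open>F n - 1\<close> might be collected from a huge set on
  which \<open>F n\<close> is close to 1. Hence the part within \<open>e\<close> of 1 is discarded
  and a relative gap \<open>1 + e\<close> is kept beside the linear one; together they give Chernoff
  bounds that are exponential in \<open>n\<close>, so summable. The discarded part is controlled
  because \<open>F (Suc n)\<close> is \<open>f\<close> times \<open>F n\<close> composed with
  \<open>R\<close>, and clamping nearly commutes with this operation: each step changes the integral
  by at most a quantity that depends on \<open>f\<close> and \<open>e\<close> only. For
  nonsingularity the obstacle is that \<open>f - 1\<close> is merely integrable, so the image law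
  need not have a square-integrable density. Truncating the intensities at \<open>K\<close> restores
  a second-moment bound, and the intensity cut off costs an additive error that vanishes as
  \<open>K\<close> grows.\<close>

lemma measurable_funpow:
  assumes "f \<in> N \<rightarrow>\<^sub>M N"
  shows "f ^^ n \<in> N \<rightarrow>\<^sub>M N"
  by (induction n) (use assms in \<open>auto intro: measurable_comp\<close>)

lemma AE_comp:
  assumes f: "f \<in> N \<rightarrow>\<^sub>M N" and null: "null_sets N \<subseteq> null_sets (distr N N f)"
    and "AE x in N. Q x"
  shows "AE x in N. Q (f x)"
proof -
  obtain Z where Z: "Z \<in> null_sets N" "{x \<in> space N. \<not> Q x} \<subseteq> Z"
    using assms(3) by (auto simp: eventually_ae_filter)
  have "Z \<in> null_sets (distr N N f)" using Z(1) null by blast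
  then have "f -` Z \<inter> space N \<in> null_sets N"
    using f by (simp add: null_sets_distr_iff)
  then show ?thesis
    by (rule AE_I') (use Z(2) measurable_space[OF f] in auto)
qed

lemma AE_funpow:
  assumes f: "f \<in> N \<rightarrow>\<^sub>M N" and null: "null_sets N \<subseteq> null_sets (distr N N f)"
    and "AE x in N. Q x"
  shows "AE x in N. \<forall>n. Q ((f ^^ n) x)"
proof -
  have "AE x in N. Q ((f ^^ n) x)" for n
  proof (induction n)
    case 0 show ?case using assms(3) by simp
  next
    case (Suc n)
    show ?case using AE_comp[OF f null Suc] by (simp add: funpow_swap1)
  qed
  then show ?thesis by (simp add: AE_all_countable)
qed

lemma null_sets_distr_inverse:
  assumes S: "S \<in> N \<rightarrow>\<^sub>M N" and R: "inverse_mod0 N S R"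
    and null: "null_sets (distr N N S) = null_sets N"
  shows "null_sets (distr N N R) = null_sets N"
proof -
  have Rm: "R \<in> N \<rightarrow>\<^sub>M N" and RS: "AE x in N. R (S x) = x"
    using R by (auto simp: inverse_mod0_def)
  have "Z \<in> null_sets (distr N N R) \<longleftrightarrow> Z \<in> null_sets N" if Z: "Z \<in> sets N" for Z
  proof -
    have RZ: "R -` Z \<inter> space N \<in> sets N" using Rm Z by measurable
    have "R -` Z \<inter> space N \<in> null_sets N \<longleftrightarrow> R -` Z \<inter> space N \<in> null_sets (distr N N S)"
      by (simp add: null)
    also have "\<dots> \<longleftrightarrow> emeasure N (S -` (R -` Z \<inter> space N) \<inter> space N) = 0"
      using S RZ by (simp add: null_sets_def emeasure_distr)
    also have "emeasure N (S -` (R -` Z \<inter> space N) \<inter> space N) = emeasure N Z"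
    proof (rule emeasure_eq_AE)
      show "AE x in N. x \<in> S -` (R -` Z \<inter> space N) \<inter> space N \<longleftrightarrow> x \<in> Z"
        using RS AE_space
        by eventually_elim (use measurable_space[OF S] in auto)
      show "S -` (R -` Z \<inter> space N) \<inter> space N \<in> sets N" using S RZ by measurable
    qed (fact Z)
    finally show ?thesis using Z RZ Rm by (simp add: null_sets_def emeasure_distr)
  qed
  then show ?thesis by (auto simp: null_sets_def)
qed

text \<open>The sets \<open>E k\<close> below exhaust the space, and no orbit returns to \<open>E k\<close> after \<open>k\<close> or more
  steps. So almost every orbit meets some \<open>E k\<close>, and for the least such \<open>k\<close> it has a first visit
  to \<open>E k\<close>; the points of first visit form the wandering set.\<close>

lemma totally_dissipativeI:
  assumes "finite_measure N" and S: "S \<in> N \<rightarrow>\<^sub>M N" and inv: "inverse_mod0 N S R"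
    and null: "null_sets (distr N N S) = null_sets N"
    and A: "\<And>n. A n \<in> sets N"
    and sum1: "summable (\<lambda>n. measure N (space N - A n))"
    and sum2: "summable (\<lambda>n. measure N ((S ^^ n) -` A n \<inter> space N))"
  shows "totally_dissipative N S"
proof -
  interpret finite_measure N by fact
  have R: "R \<in> N \<rightarrow>\<^sub>M N" and RS: "AE x in N. R (S x) = x" and SR: "AE x in N. S (R x) = x"
    using inv by (auto simp: inverse_mod0_def)
  have nullR: "null_sets (distr N N R) = null_sets N"
    by (rule null_sets_distr_inverse[OF S inv null])
  note [measurable] = measurable_funpow[OF S] measurable_funpow[OF R] A
  \<comment> \<open>Integer powers of \<open>S\<close>. They obey the group law only along almost
    every orbit; this is what \<open>step\<close> and \<open>UU\<close> provide.\<close>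
  define U where "U n = (if n \<ge> 0 then S ^^ nat n else R ^^ nat (- n))" for n :: int
  have U_meas [measurable]: "U n \<in> N \<rightarrow>\<^sub>M N" for n by (simp add: U_def)
  \<comment> \<open>If \<open>x\<close> and \<open>(S ^^ n) x\<close> were both in
    \<open>E k\<close> for some \<open>n \<ge> k\<close>, the second membership would put
    \<open>(S ^^ n) x\<close> into \<open>A n\<close> and the first would exclude it.\<close>
  define E where "E k = {x \<in> space N. \<forall>n\<ge>k. x \<in> A n \<and> (S ^^ n) x \<notin> A n}" for k
  have E_meas [measurable]: "E k \<in> sets N" for k unfolding E_def by measurable
  define B where "B = {x \<in> space N. \<exists>k. x \<in> E k \<and> (\<forall>j<0. U j x \<notin> E k) \<and> (\<forall>l<k. \<forall>j. U j x \<notin> E l)}"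
  have B_meas [measurable]: "B \<in> sets N" unfolding B_def by measurable
  \<comment> \<open>A point lies in the \<open>n\<close>-th image of \<open>B\<close> if it was in
    \<open>B\<close> \<open>n\<close> steps ago, hence the sign.\<close>
  have pi: "power_image N S R n B = U (- n) -` B \<inter> space N" for n
    by (cases "n = 0") (auto simp: power_image_def U_def)
  have "AE x in N. R (S x) = x \<and> S (R x) = x" using RS SR by eventually_elim auto
  then have "AE x in N. (\<forall>n. R (S ((S ^^ n) x)) = (S ^^ n) x \<and> S (R ((S ^^ n) x)) = (S ^^ n) x) \<and>
      (\<forall>n. R (S ((R ^^ n) x)) = (R ^^ n) x \<and> S (R ((R ^^ n) x)) = (R ^^ n) x)"
    by (intro AE_conjI AE_funpow[OF S] AE_funpow[OF R]) (auto simp: null nullR)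
  then have step: "AE x in N. \<forall>n. S (U n x) = U (n + 1) x \<and> R (U n x) = U (n - 1) x"
  proof (rule eventually_mono, intro allI conjI)
    fix x :: 'a and n :: int
    assume H: "(\<forall>n. R (S ((S ^^ n) x)) = (S ^^ n) x \<and> S (R ((S ^^ n) x)) = (S ^^ n) x) \<and>
      (\<forall>n. R (S ((R ^^ n) x)) = (R ^^ n) x \<and> S (R ((R ^^ n) x)) = (R ^^ n) x)"
    show "S (U n x) = U (n + 1) x"
    proof (cases "n \<ge> 0")
      case True
      then have "nat (n + 1) = Suc (nat n)" by simp
      with True show ?thesis by (simp add: U_def)
    next
      case False
      define m where "m = nat (- n - 1)"
      have n: "n = - int (Suc m)" using False by (simp add: m_def)
      show ?thesis using H[THEN conjunct2, rule_format, of m] by (cases m) (auto simp: n U_def nat_add_distrib)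
    qed
    show "R (U n x) = U (n - 1) x"
    proof (cases "n \<le> 0")
      case True
      then have "nat (- (n - 1)) = Suc (nat (- n))" by simp
      with True show ?thesis by (auto simp: U_def)
    next
      case False
      define m where "m = nat (n - 1)"
      have n: "n = int (Suc m)" using False by (simp add: m_def)
      show ?thesis using H[THEN conjunct1, rule_format, of m] by (auto simp: n U_def nat_add_distrib)
    qed
  qed
  have "AE x in N. eventually (\<lambda>n. x \<in> space N - (space N - A n)) sequentially"
    by (rule borel_cantelli_AE1[OF _ _ sum1]) (auto simp: emeasure_eq_measure)
  moreover have "AE x in N. eventually (\<lambda>n. x \<in> space N - ((S ^^ n) -` A n \<inter> space N)) sequentially"
    by (rule borel_cantelli_AE1[OF _ _ sum2]) (auto simp: emeasure_eq_measure)
  ultimately have ev: "AE x in N. \<exists>k. x \<in> E k"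
    using AE_space
  proof eventually_elim
    case (elim x)
    have "eventually (\<lambda>n. x \<in> A n \<and> (S ^^ n) x \<notin> A n) sequentially"
      using elim(1,2) by eventually_elim (use elim(3) in auto)
    then show ?case using elim(3) by (auto simp: E_def eventually_sequentially)
  qed
  have part: "AE x in N. \<exists>!n. U n x \<in> B"
    using step ev AE_space
  proof eventually_elim
    case (elim x)
    have UU: "U m (U n x) = U (m + n) x" for m n
    proof (cases "m \<ge> 0")
      case True
      have "(S ^^ k) (U n x) = U (int k + n) x" for k
        by (induction k) (use elim(1) in \<open>auto simp: algebra_simps\<close>)
      from this[of "nat m"] have "(S ^^ nat m) (U n x) = U (m + n) x" using True by simp
      moreover have "U m = S ^^ nat m" using True by (simp add: U_def)
      ultimately show ?thesis by simp
    next
      case False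
      have "(R ^^ k) (U n x) = U (n - int k) x" for k
        by (induction k) (use elim(1) in \<open>auto simp: algebra_simps\<close>)
      from this[of "nat (- m)"] have "(R ^^ nat (- m)) (U n x) = U (m + n) x"
        using False by (simp add: add.commute)
      moreover have "U m = R ^^ nat (- m)" using False by (simp add: U_def)
      ultimately show ?thesis by simp
    qed
    have sp: "U n x \<in> space N" for n using elim(3) U_meas measurable_space by metis
    have gap: "U j x \<notin> E k" if "U i x \<in> E k" "j \<ge> i + int k" for i j k
    proof
      assume j: "U j x \<in> E k"
      define d where "d = nat (j - i)"
      have d: "d \<ge> k" "j = int d + i" using that(2) by (auto simp: d_def)
      have "(S ^^ d) (U i x) \<notin> A d" using that(1) d(1) by (auto simp: E_def)
      moreover have "(S ^^ d) (U i x) = U j x" using UU[of "int d" i] d(2) by (simp add: U_def)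
      moreover have "U j x \<in> A d" using j d(1) by (auto simp: E_def)
      ultimately show False by simp
    qed
    have B_iff: "U n x \<in> B \<longleftrightarrow>
        (\<exists>k. U n x \<in> E k \<and> (\<forall>j<n. U j x \<notin> E k) \<and> (\<forall>l<k. \<forall>j. U j x \<notin> E l))" (is "_ \<longleftrightarrow> ?r") for n
    proof -
      have "(\<forall>j<0. U (j + n) x \<notin> E k) \<longleftrightarrow> (\<forall>j<n. U j x \<notin> E k)" for k
        by (metis add_less_cancel_right add_0 diff_add_cancel)
      moreover have "(\<forall>j. U (j + n) x \<notin> E k) \<longleftrightarrow> (\<forall>j. U j x \<notin> E k)" for k
        by (metis diff_add_cancel)
      ultimately show ?thesis using sp[of n] by (simp add: B_def UU)
    qed
    define k where "k = (LEAST k. \<exists>j. U j x \<in> E k)"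
    have "U 0 x = x" by (simp add: U_def)
    then have ex: "\<exists>k. \<exists>j. U j x \<in> E k" using elim(2) by metis
    then have "\<exists>j. U j x \<in> E k" unfolding k_def by (rule LeastI_ex)
    then obtain i where i: "U i x \<in> E k" by blast
    have kmin: "U j x \<notin> E l" if "l < k" for j l
      using that not_less_Least unfolding k_def by blast
    \<comment> \<open>By \<open>gap\<close> a visit before time \<open>i - int k\<close> would
      forbid the visit at time \<open>i\<close>. Counting time from there makes the visiting times
      natural numbers, so that a first one exists.\<close>
    define V where "V = {d::nat. U (i - int k + int d) x \<in> E k}"
    have "V \<noteq> {}" using i by (auto simp: V_def intro!: exI[of _ k])
    define d where "d = (LEAST d. d \<in> V)"
    have dV: "d \<in> V" unfolding d_def using \<open>V \<noteq> {}\<close> by (metis LeastI ex_in_conv)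
    define n where "n = i - int k + int d"
    have n1: "U n x \<in> E k" using dV by (simp add: V_def n_def)
    have n2: "U j x \<notin> E k" if "j < n" for j
    proof (cases "j < i - int k")
      case True
      then show ?thesis using gap[of j k i] i by auto
    next
      case False
      define e where "e = nat (j - (i - int k))"
      have e: "j = i - int k + int e" using False by (simp add: e_def)
      then have "e < d" using that by (simp add: n_def)
      then have "e \<notin> V" unfolding d_def using not_less_Least by blast
      then show ?thesis by (simp add: V_def e)
    qed
    show ?case
    proof (rule ex1I)
      show "U n x \<in> B" using n1 n2 kmin by (auto simp: B_iff)
    next
      fix m assume "U m x \<in> B"
      then obtain l where l: "U m x \<in> E l" "\<And>j. j < m \<Longrightarrow> U j x \<notin> E l"
          "\<And>l' j. l' < l \<Longrightarrow> U j x \<notin> E l'" by (auto simp: B_iff)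
      have "l = k" using l(1,3) n1 kmin by (metis linorder_neqE_nat)
      then show "m = n" using l n1 n2 by (metis linorder_neqE)
    qed
  qed
  have "power_image N S R m B \<inter> power_image N S R n B \<in> null_sets N" if "m \<noteq> n" for m n
  proof (subst AE_iff_null_sets)
    show "power_image N S R m B \<inter> power_image N S R n B \<in> sets N" unfolding pi by measurable
    show "AE x in N. x \<notin> power_image N S R m B \<inter> power_image N S R n B"
      using part
    proof eventually_elim
      case (elim x)
      then have "\<not> (U (- m) x \<in> B \<and> U (- n) x \<in> B)" using that by (metis neg_equal_iff_equal)
      then show ?case by (auto simp: pi)
    qed
  qed
  moreover have "space N - (\<Union>n. power_image N S R n B) \<in> null_sets N"
  proof (subst AE_iff_null_sets)
    show "space N - (\<Union>n. power_image N S R n B) \<in> sets N" unfolding pi by measurable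
    show "AE x in N. x \<notin> space N - (\<Union>n. power_image N S R n B)"
      using part
    proof eventually_elim
      case (elim x)
      then obtain n where "U n x \<in> B" by auto
      then have "x \<in> space N \<longrightarrow> x \<in> power_image N S R (- n) B" by (simp add: pi)
      then show ?case by auto
    qed
  qed
  moreover have "S \<in> Aut N" using S inv null by (auto simp: Aut_def)
  ultimately show ?thesis
    using inv B_meas unfolding totally_dissipative_def by blast
qed

section \<open>Counts of a Poisson process\<close>

lemma space_point_measures:
  "space (point_measures M) =
    {w. sets w = sets M \<and> (\<forall>C\<in>sets M. emeasure w C \<in> insert \<infinity> (range of_nat))}"
proof -
  have "sets M \<noteq> {}" by auto
  then show ?thesis by (auto simp: point_measures_def space_Sup_eq_UN)
qed

lemma measurable_emeasure_point_measures [measurable]: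
  "A \<in> sets M \<Longrightarrow> (\<lambda>w. emeasure w A) \<in> borel_measurable (point_measures M)"
  by (auto intro!: measurable_Sup1 measurable_vimage_algebra1 simp: point_measures_def)

lemma measurable_point_measures:
  assumes "\<And>w. w \<in> space N \<Longrightarrow> K w \<in> space (point_measures M)"
    and "\<And>A. A \<in> sets M \<Longrightarrow> (\<lambda>w. emeasure (K w) A) \<in> borel_measurable N"
  shows "K \<in> N \<rightarrow>\<^sub>M point_measures M"
proof -
  have "sets M \<noteq> {}" by auto
  then show ?thesis using assms unfolding space_point_measures
    by (auto intro!: measurable_Sup2 measurable_vimage_algebra2 simp: point_measures_def)
qed

lemma sets_point_measuresD: "w \<in> space (point_measures M) \<Longrightarrow> sets w = sets M"
  and space_point_measuresD: "w \<in> space (point_measures M) \<Longrightarrow> space w = space M"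
  by (auto simp: space_point_measures dest: sets_eq_imp_space_eq)

lemma emeasure_suspension:
  assumes "T \<in> M \<rightarrow>\<^sub>M M" "w \<in> space (point_measures M)" "A \<in> sets M"
  shows "emeasure (suspension M T w) A = emeasure w (T -` A \<inter> space M)"
  unfolding suspension_def
  using assms sets_point_measuresD[OF assms(2)] space_point_measuresD[OF assms(2)]
  by (subst emeasure_distr) (auto cong: measurable_cong_sets)

lemma suspension_in_space:
  assumes T: "T \<in> M \<rightarrow>\<^sub>M M" and w: "w \<in> space (point_measures M)"
  shows "suspension M T w \<in> space (point_measures M)"
proof -
  have "emeasure (suspension M T w) C \<in> insert \<infinity> (range of_nat)" if "C \<in> sets M" for C
  proof -
    have "T -` C \<inter> space M \<in> sets M" using T that by measurable
    then show ?thesis using w emeasure_suspension[OF T w that] by (auto simp: space_point_measures)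
  qed
  then show ?thesis by (simp add: space_point_measures) (simp add: suspension_def)
qed

lemma measurable_suspension:
  assumes T: "T \<in> M \<rightarrow>\<^sub>M M"
  shows "suspension M T \<in> point_measures M \<rightarrow>\<^sub>M point_measures M"
proof (rule measurable_point_measures)
  fix A assume A: "A \<in> sets M"
  then have "T -` A \<inter> space M \<in> sets M" using T by measurable
  then show "(\<lambda>w. emeasure (suspension M T w) A) \<in> borel_measurable (point_measures M)"
    by (subst measurable_cong[OF emeasure_suspension[OF T _ A]]) auto
qed (fact suspension_in_space[OF T])

text \<open>A natural number suits discrete laws and exponents better than an
  \<open>ennreal\<close>. Infinite mass becomes 0; by \<open>AE_emeasure_cnt\<close> this happens
  with probability 0 on sets of finite intensity.\<close>

definition cnt :: "'a set \<Rightarrow> 'a measure \<Rightarrow> nat" where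
  "cnt A w = nat \<lfloor>enn2real (emeasure w A)\<rfloor>"

lemma cnt_eqI: "emeasure w A = of_nat k \<Longrightarrow> cnt A w = k"
  by (simp add: cnt_def enn2real_of_nat)

lemma measurable_cnt [measurable]:
  "A \<in> sets M \<Longrightarrow> cnt A \<in> point_measures M \<rightarrow>\<^sub>M count_space UNIV"
  unfolding cnt_def by measurable

lemma cnt_suspension:
  assumes "T \<in> M \<rightarrow>\<^sub>M M" "w \<in> space (point_measures M)" "A \<in> sets M"
  shows "cnt A (suspension M T w) = cnt (T -` A \<inter> space M) w"
  unfolding cnt_def emeasure_suspension[OF assms] ..

lemma suspension_funpow:
  assumes T: "T \<in> M \<rightarrow>\<^sub>M M" and w: "w \<in> space (point_measures M)"
  shows "(suspension M T ^^ n) w = suspension M (T ^^ n) w"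
proof (induction n)
  case 0
  have "distr w M id = w"
    using sets_point_measuresD[OF w] by (intro distr_id2[unfolded id_def[symmetric]]) auto
  then show ?case by (simp add: suspension_def id_def)
next
  case (Suc n)
  have "T ^^ n \<in> M \<rightarrow>\<^sub>M M" by (induction n) (use T in \<open>auto intro: measurable_comp\<close>)
  then have "T ^^ n \<in> w \<rightarrow>\<^sub>M M" using sets_point_measuresD[OF w] by (auto cong: measurable_cong_sets)
  then show ?case using T Suc by (simp add: suspension_def distr_distr comp_def)
qed

section \<open>Poisson counts: generating function, Chernoff bounds, independence\<close>

locale poisson_process = M: sigma_finite_measure M for M :: "'a measure" +
  fixes P :: "'a measure measure"
  assumes law: "poisson_law M P"
begin

sublocale prob_space P
  using law by (simp add: poisson_law_def)

lemma sets_P [measurable_cong]: "sets P = sets (point_measures M)"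
  using law by (simp add: poisson_law_def)

lemma space_P: "space P = space (point_measures M)"
  using sets_P by (rule sets_eq_imp_space_eq)

lemma suspension_measurable: "T \<in> M \<rightarrow>\<^sub>M M \<Longrightarrow> suspension M T \<in> P \<rightarrow>\<^sub>M P"
  using measurable_suspension[of T M] by (simp cong: measurable_cong_sets add: sets_P)

lemma prob_eq:
  "A \<in> sets M \<Longrightarrow> emeasure M A < \<infinity> \<Longrightarrow>
    prob {w \<in> space P. emeasure w A = of_nat k} = measure M A ^ k / fact k * exp (- measure M A)"
  using law by (simp add: poisson_law_def)

text \<open>The Poisson weights sum to 1, so the events of a finite count exhaust the space up to a
  null set.\<close>

lemma AE_emeasure_cnt:
  assumes [measurable]: "A \<in> sets M" and fin: "emeasure M A < \<infinity>"
  shows "AE w in P. emeasure w A = of_nat (cnt A w)"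
proof -
  let ?E = "\<lambda>k::nat. {w \<in> space P. emeasure w A = of_nat k}"
  have [measurable]: "?E k \<in> sets P" for k by measurable
  have "(\<lambda>k. prob (?E k)) sums prob (\<Union>k. ?E k)"
    by (rule finite_measure_UNION) (auto simp: disjoint_family_on_def)
  moreover have "(\<lambda>k. (measure M A ^ k /\<^sub>R fact k) * exp (- measure M A)) sums
      (exp (measure M A) * exp (- measure M A))"
    by (intro sums_mult2 exp_converges)
  moreover have "measure M A ^ k / fact k * exp (- measure M A) =
      (measure M A ^ k /\<^sub>R fact k) * exp (- measure M A)" for k
    by (simp add: divide_inverse)
  ultimately have "prob (\<Union>k. ?E k) = exp (measure M A) * exp (- measure M A)"
    unfolding prob_eq[OF assms] by (simp only:) (rule sums_unique2)
  then have "prob (\<Union>k. ?E k) = 1" by (simp add: exp_add[symmetric])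
  then have "AE w in P. w \<in> (\<Union>k. ?E k)"
    by (subst (asm) prob_eq_1) auto
  then show ?thesis by eventually_elim (auto dest: cnt_eqI)
qed

lemma prob_cnt:
  assumes [measurable]: "A \<in> sets M" and fin: "emeasure M A < \<infinity>"
  shows "prob {w \<in> space P. cnt A w = k} = measure M A ^ k / fact k * exp (- measure M A)"
proof -
  have "prob {w \<in> space P. cnt A w = k} = prob {w \<in> space P. emeasure w A = of_nat k}"
  proof (rule finite_measure_eq_AE)
    show "AE w in P. w \<in> {w \<in> space P. cnt A w = k} \<longleftrightarrow> w \<in> {w \<in> space P. emeasure w A = of_nat k}"
      using AE_emeasure_cnt[OF assms] by eventually_elim (auto dest: cnt_eqI)
  qed measurable
  then show ?thesis by (simp add: prob_eq[OF assms])
qed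

lemma nn_integral_cnt:
  assumes A [measurable]: "A \<in> sets M" and fin: "emeasure M A < \<infinity>"
  shows "(\<integral>\<^sup>+w. g (cnt A w) \<partial>P) =
    (\<Sum>k. ennreal (measure M A ^ k / fact k * exp (- measure M A)) * g k)"
proof -
  let ?p = "\<lambda>k. ennreal (measure M A ^ k / fact k * exp (- measure M A))"
  have "distr P (count_space UNIV) (cnt A) = density (count_space UNIV) ?p"
  proof (rule measure_eqI_countable)
    fix k
    have "cnt A -` {k} \<inter> space P = {w \<in> space P. cnt A w = k}" by auto
    then show "emeasure (distr P (count_space UNIV) (cnt A)) {k} =
        emeasure (density (count_space UNIV) ?p) {k}"
      by (simp add: emeasure_distr emeasure_density emeasure_eq_measure prob_cnt[OF assms])
  qed auto
  moreover have "(\<integral>\<^sup>+w. g (cnt A w) \<partial>P) = (\<integral>\<^sup>+k. g k \<partial>distr P (count_space UNIV) (cnt A))"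
    by (subst nn_integral_distr) measurable
  ultimately show ?thesis by (simp add: nn_integral_density nn_integral_count_space_nat)
qed

text \<open>The generating function of the Poisson distribution. It yields the tail bounds below and
  later the normalisation and the second moment of a likelihood ratio.\<close>

lemma nn_integral_power_cnt:
  assumes "A \<in> sets M" "emeasure M A < \<infinity>" "0 \<le> r"
  shows "(\<integral>\<^sup>+w. ennreal (r ^ cnt A w) \<partial>P) = ennreal (exp (measure M A * (r - 1)))"
proof -
  let ?a = "measure M A"
  have "(\<lambda>k. ((?a * r) ^ k /\<^sub>R fact k) * exp (- ?a)) sums (exp (?a * r) * exp (- ?a))"
    by (intro sums_mult2 exp_converges)
  moreover have "((?a * r) ^ k /\<^sub>R fact k) * exp (- ?a) = (?a ^ k / fact k * exp (- ?a)) * r ^ k" for k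
    by (simp add: power_mult_distrib divide_inverse)
  moreover have "exp (?a * r) * exp (- ?a) = exp (?a * (r - 1))"
    by (simp add: mult_exp_exp algebra_simps)
  ultimately have s: "(\<lambda>k. (?a ^ k / fact k * exp (- ?a)) * r ^ k) sums exp (?a * (r - 1))"
    by (simp only:)
  have "(\<integral>\<^sup>+w. ennreal (r ^ cnt A w) \<partial>P) = (\<Sum>k. ennreal ((?a ^ k / fact k * exp (- ?a)) * r ^ k))"
    unfolding nn_integral_cnt[OF assms(1,2), of "\<lambda>k. ennreal (r ^ k)"] using assms(3)
    by (subst ennreal_mult[symmetric]) auto
  also have "\<dots> = ennreal (exp (?a * (r - 1)))"
    using s assms(3) by (intro suminf_ennreal_eq) auto
  finally show ?thesis .
qed

text \<open>Markov's inequality for \<open>r ^ cnt A w\<close>. The factor \<open>ln r\<close> on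
  both sides covers both tails: the event is an upper tail for \<open>r > 1\<close> and a lower tail
  for \<open>r < 1\<close>.\<close>

lemma prob_cnt_tail:
  assumes A [measurable]: "A \<in> sets M" and fin: "emeasure M A < \<infinity>" and r: "0 < r"
  shows "prob {w \<in> space P. s * ln r \<le> cnt A w * ln r} \<le> exp (measure M A * (r - 1) - s * ln r)"
proof -
  let ?E = "{w \<in> space P. s * ln r \<le> cnt A w * ln r}"
  have [measurable]: "?E \<in> sets P" by measurable
  have "emeasure P ?E = (\<integral>\<^sup>+w. indicator ?E w \<partial>P)"
    by (rule nn_integral_indicator[symmetric]) measurable
  also have "\<dots> \<le> (\<integral>\<^sup>+w. ennreal (exp (- s * ln r)) * ennreal (r ^ cnt A w) \<partial>P)"
  proof (rule nn_integral_mono)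
    fix w
    have "exp (- s * ln r) * r ^ cnt A w = exp (cnt A w * ln r - s * ln r)"
      using r exp_of_nat_mult[of "cnt A w" "ln r"] by (simp add: exp_diff exp_minus field_simps)
    then have "ennreal (exp (- s * ln r)) * ennreal (r ^ cnt A w) = ennreal (exp (cnt A w * ln r - s * ln r))"
      using r by (subst ennreal_mult[symmetric]) auto
    moreover have "1 \<le> ennreal (exp (cnt A w * ln r - s * ln r))" if "w \<in> ?E"
      using that by simp
    ultimately show "indicator ?E w \<le> ennreal (exp (- s * ln r)) * ennreal (r ^ cnt A w)"
      by (cases "w \<in> ?E") auto
  qed
  also have "\<dots> = ennreal (exp (- s * ln r)) * ennreal (exp (measure M A * (r - 1)))"
    by (subst nn_integral_cmult) (use nn_integral_power_cnt[OF A fin] r in auto)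
  also have "\<dots> = ennreal (exp (measure M A * (r - 1) - s * ln r))"
    by (simp add: ennreal_mult[symmetric] mult_exp_exp)
  finally show ?thesis by (simp add: emeasure_eq_measure)
qed

text \<open>The threshold balances the two Chernoff bounds, with exponential weights \<open>1 + \<epsilon>\<close> and
  \<open>1 / (1 + \<epsilon>)\<close> per point.\<close>

lemma prob_cnt_separation:
  assumes A: "A \<in> sets M" "emeasure M A < \<infinity>" and B: "B \<in> sets M" "emeasure M B < \<infinity>"
    and e: "0 < e" and gap: "(1 + e) * measure M A + t \<le> measure M B"
  obtains s where "prob {w \<in> space P. s \<le> real (cnt A w)} \<le> exp (- (e / (2 * (1 + e))) * t)"
    "prob {w \<in> space P. real (cnt B w) < s} \<le> exp (- (e / (2 * (1 + e))) * t)"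
proof -
  let ?a = "measure M A" and ?b = "measure M B"
  define r where "r = 1 + e"
  have r: "r > 1" "ln r > 0" using e by (auto simp: r_def)
  define s where "s = (?a * (r - 1) - ?b * (1 / r - 1)) / (2 * ln r)"
  have sl: "s * ln r = (?a * (r - 1) - ?b * (1 / r - 1)) / 2" using r by (simp add: s_def)
  \<comment> \<open>The left side is the exponent shared by the two balanced bounds.\<close>
  have key: "(?a * (r - 1) + ?b * (1 / r - 1)) / 2 \<le> - (e / (2 * (1 + e))) * t"
  proof -
    have "?a * (r - 1) + ?b * (1 / r - 1) = (e / r) * (r * ?a - ?b)"
      using r(1) by (simp add: field_simps r_def)
    also have "\<dots> \<le> (e / r) * (- t)"
      using gap e r(1) by (intro mult_left_mono) (auto simp: r_def)
    finally show ?thesis using e by (simp add: r_def field_simps)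
  qed
  have balance: "X - S \<le> Z" "Y + S \<le> Z" if "(X + Y) / 2 \<le> Z" "S = (X - Y) / 2" for X Y Z S :: real
    using that by (simp_all add: field_simps)
  have "prob {w \<in> space P. s \<le> real (cnt A w)} \<le> exp (?a * (r - 1) - s * ln r)"
    using prob_cnt_tail[OF A, of r s] r by simp
  also have "\<dots> \<le> exp (- (e / (2 * (1 + e))) * t)"
    using balance(1)[OF key sl] by simp
  finally have 1: "prob {w \<in> space P. s \<le> real (cnt A w)} \<le> exp (- (e / (2 * (1 + e))) * t)" .
  have [measurable]: "B \<in> sets M" by fact
  have "prob {w \<in> space P. real (cnt B w) < s} \<le> prob {w \<in> space P. s * ln (1 / r) \<le> cnt B w * ln (1 / r)}"
    using r by (intro finite_measure_mono) (auto simp: ln_div)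
  also have "\<dots> \<le> exp (?b * (1 / r - 1) - s * ln (1 / r))"
    using prob_cnt_tail[OF B, of "1 / r" s] r by simp
  also have "\<dots> \<le> exp (- (e / (2 * (1 + e))) * t)"
    using balance(2)[OF key sl] r by (simp add: ln_div)
  finally have 2: "prob {w \<in> space P. real (cnt B w) < s} \<le> exp (- (e / (2 * (1 + e))) * t)" .
  show thesis using that[OF 1 2] .
qed

lemma indep_vars_cnt:
  assumes "disjoint_family A" "\<And>i::nat. A i \<in> sets M" "\<And>i. emeasure M (A i) < \<infinity>"
  shows "indep_vars (\<lambda>_. count_space UNIV) (\<lambda>i. cnt (A i)) UNIV"
proof -
  have "indep_vars (\<lambda>_. borel) (\<lambda>i w. emeasure w (A i)) UNIV"
    using law assms unfolding poisson_law_def by blast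
  then show ?thesis unfolding cnt_def
    by (rule indep_vars_compose2) measurable
qed

end

section \<open>Linear growth along an integrable cocycle\<close>

text \<open>Passing to real values is harmless only if the derivative is finite almost everywhere,
  which requires the image measure to be sigma-finite. Pulling a sigma-finite cover back along
  \<open>R\<close> shows that it is.\<close>

lemma Aut1_density:
  assumes "sigma_finite_measure M" "T \<in> Aut1 M"
  shows "distr M M T = density M (\<lambda>x. ennreal (nonsing_deriv M T x))"
proof -
  interpret sigma_finite_measure M by fact
  obtain R where T: "T \<in> M \<rightarrow>\<^sub>M M" and R: "R \<in> M \<rightarrow>\<^sub>M M" and RT: "AE x in M. R (T x) = x"
    and null: "null_sets (distr M M T) = null_sets M"
    using assms(2) by (auto simp: Aut1_def Aut_def inverse_mod0_def)
  have ac: "absolutely_continuous M (distr M M T)"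
    by (simp add: absolutely_continuous_def null)
  have "sigma_finite_measure (distr M M T)"
  proof
    obtain A where A: "countable A" "A \<subseteq> sets M" "\<Union>A = space M" "\<And>a. a \<in> A \<Longrightarrow> emeasure M a \<noteq> \<infinity>"
      using sigma_finite_countable by metis
    let ?A = "(\<lambda>a. R -` a \<inter> space M) ` A"
    have "emeasure (distr M M T) (R -` a \<inter> space M) = emeasure M a" if "a \<in> A" for a
    proof -
      have a: "a \<in> sets M" using that A by auto
      then have Ra: "R -` a \<inter> space M \<in> sets M" using R by measurable
      then have "emeasure (distr M M T) (R -` a \<inter> space M) =
          emeasure M (T -` (R -` a \<inter> space M) \<inter> space M)"
        by (simp add: emeasure_distr T)
      also have "\<dots> = emeasure M a"
      proof (rule emeasure_eq_AE)
        show "AE x in M. x \<in> T -` (R -` a \<inter> space M) \<inter> space M \<longleftrightarrow> x \<in> a"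
          using RT AE_space by eventually_elim (use measurable_space[OF T] in auto)
        show "T -` (R -` a \<inter> space M) \<inter> space M \<in> sets M" using T Ra by measurable
      qed fact
      finally show ?thesis .
    qed
    moreover have "\<Union>?A = R -` (\<Union>A) \<inter> space M" by auto
    then have "\<Union>?A = space M" unfolding A(3) using measurable_space[OF R] by auto
    moreover have "?A \<subseteq> sets M" using A(2) R by (auto intro: measurable_sets)
    ultimately show "\<exists>A. countable A \<and> A \<subseteq> sets (distr M M T) \<and> \<Union>A = space (distr M M T) \<and>
        (\<forall>a\<in>A. emeasure (distr M M T) a \<noteq> \<infinity>)"
      using A(1,4) by (intro exI[of _ ?A]) auto
  qed
  then have "AE x in M. RN_deriv M (distr M M T) x \<noteq> \<infinity>"
    by (rule RN_deriv_finite) (use ac in auto)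
  then have "density M (\<lambda>x. ennreal (nonsing_deriv M T x)) = density M (RN_deriv M (distr M M T))"
    unfolding nonsing_deriv_def
    by (intro density_cong) (auto simp: less_top elim!: eventually_mono)
  also have "\<dots> = distr M M T" by (rule density_RN_deriv[OF ac]) simp
  finally show ?thesis ..
qed

text \<open>Formulated with an arbitrary density \<open>f\<close> and an explicit inverse
  \<open>R\<close>, so that the inverse transformation is an instance as well; see
  \<open>integrable_cocycle_inverse\<close>.\<close>

locale integrable_cocycle =
  fixes M :: "'a measure" and T R :: "'a \<Rightarrow> 'a" and f :: "'a \<Rightarrow> real"
  assumes T [measurable]: "T \<in> M \<rightarrow>\<^sub>M M" and inverse: "inverse_mod0 M T R"
    and f [measurable]: "f \<in> borel_measurable M" and f_nonneg: "\<And>x. 0 \<le> f x"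
    and distr_T: "distr M M T = density M (\<lambda>x. ennreal (f x))"
    and f_integrable: "integrable M (\<lambda>x. f x - 1)"
begin

lemma R [measurable]: "R \<in> M \<rightarrow>\<^sub>M M" and RT: "AE x in M. R (T x) = x"
  using inverse by (auto simp: inverse_mod0_def)

lemma nn_integral_transfer:
  assumes [measurable]: "u \<in> borel_measurable M" "v \<in> borel_measurable M"
  shows "(\<integral>\<^sup>+y. ennreal (f y) * (u (R y) * v y) \<partial>M) = (\<integral>\<^sup>+x. u x * v (T x) \<partial>M)"
proof -
  have "(\<integral>\<^sup>+y. ennreal (f y) * (u (R y) * v y) \<partial>M) = (\<integral>\<^sup>+y. u (R y) * v y \<partial>distr M M T)"
    unfolding distr_T by (subst nn_integral_density) auto
  also have "\<dots> = (\<integral>\<^sup>+x. u (R (T x)) * v (T x) \<partial>M)"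
    by (subst nn_integral_distr) auto
  also have "\<dots> = (\<integral>\<^sup>+x. u x * v (T x) \<partial>M)"
    by (rule nn_integral_cong_AE) (use RT in \<open>eventually_elim, simp\<close>)
  finally show ?thesis .
qed

text \<open>The transfer operator, which sends \<open>u\<close> to \<open>f\<close> times
  \<open>u\<close> composed with \<open>R\<close>, preserves integrals: it is the dual of
  composition with \<open>T\<close>.\<close>

lemma
  fixes u :: "'a \<Rightarrow> real"
  assumes u: "integrable M u"
  shows integrable_transfer: "integrable M (\<lambda>y. f y * u (R y))"
    and integral_transfer: "(\<integral>y. f y * u (R y) \<partial>M) = (\<integral>x. u x \<partial>M)"
proof -
  have [measurable]: "u \<in> borel_measurable M" using u by auto
  have eq: "AE x in M. u (R (T x)) = u x" using RT by eventually_elim simp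
  have "integrable M (\<lambda>x. u (R (T x)))"
    using u by (subst integrable_cong_AE[OF _ _ eq]) auto
  then have "integrable (distr M M T) (\<lambda>y. u (R y))" by (subst integrable_distr_eq) auto
  then show "integrable M (\<lambda>y. f y * u (R y))"
    unfolding distr_T by (subst (asm) integrable_density) (auto simp: f_nonneg)
  have "(\<integral>y. f y * u (R y) \<partial>M) = (\<integral>y. u (R y) \<partial>distr M M T)"
    unfolding distr_T by (subst integral_density) (auto simp: f_nonneg)
  also have "\<dots> = (\<integral>x. u (R (T x)) \<partial>M)" by (subst integral_distr) auto
  also have "\<dots> = (\<integral>x. u x \<partial>M)" by (rule integral_cong_AE) (use eq in auto)
  finally show "(\<integral>y. f y * u (R y) \<partial>M) = (\<integral>x. u x \<partial>M)" .
qed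

text \<open>The transfer operator iterated on the constant 1; by \<open>distr_funpow\<close> this is
  the chain rule for the densities of the powers of \<open>T\<close>.\<close>

primrec F :: "nat \<Rightarrow> 'a \<Rightarrow> real" where
  "F 0 = (\<lambda>_. 1)"
| "F (Suc n) = (\<lambda>x. f x * F n (R x))"

lemma F_measurable [measurable]: "F n \<in> borel_measurable M"
  by (induction n) auto

lemma F_nonneg: "0 \<le> F n x"
  by (induction n arbitrary: x) (auto simp: f_nonneg)

lemma distr_funpow: "distr M M (T ^^ n) = density M (\<lambda>x. ennreal (F n x))"
proof (induction n)
  case 0
  then show ?case by (simp add: density_1 distr_id2[of M M, unfolded id_def[symmetric]] id_def)
next
  case (Suc n)
  have Tn [measurable]: "T ^^ n \<in> M \<rightarrow>\<^sub>M M" by (rule measurable_funpow[OF T])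
  have "distr M M (T ^^ Suc n) = distr (density M (\<lambda>x. ennreal (F n x))) M T"
    unfolding Suc[symmetric] by (simp add: distr_distr comp_def)
  also have "\<dots> = density M (\<lambda>x. ennreal (F (Suc n) x))"
  proof (rule measure_eqI)
    fix A assume "A \<in> sets (distr (density M (\<lambda>x. ennreal (F n x))) M T)"
    then have A [measurable]: "A \<in> sets M" by simp
    have "emeasure (distr (density M (\<lambda>x. ennreal (F n x))) M T) A =
        (\<integral>\<^sup>+x. ennreal (F n x) * indicator A (T x) \<partial>M)"
      by (subst emeasure_distr, simp, simp, subst emeasure_density, simp, simp)
        (auto intro!: nn_integral_cong split: split_indicator)
    also have "\<dots> = (\<integral>\<^sup>+y. ennreal (f y) * (ennreal (F n (R y)) * indicator A y) \<partial>M)"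
      by (rule nn_integral_transfer[symmetric]) auto
    also have "\<dots> = emeasure (density M (\<lambda>x. ennreal (F (Suc n) x))) A"
      by (subst emeasure_density) (auto simp: ennreal_mult f_nonneg F_nonneg ac_simps)
    finally show "emeasure (distr (density M (\<lambda>x. ennreal (F n x))) M T) A =
        emeasure (density M (\<lambda>x. ennreal (F (Suc n) x))) A" .
  qed simp
  finally show ?case .
qed

text \<open>\<open>F (Suc n) - 1\<close> is the transfer of \<open>F n - 1\<close> plus
  \<open>f - 1\<close>, so every step adds the same amount. The subtraction of 1 is essential, as
  \<open>F n\<close> itself is not integrable on a space of infinite measure.\<close>

lemma F_integrable: "integrable M (\<lambda>x. F n x - 1)"
  and F_integral: "(\<integral>x. F n x - 1 \<partial>M) = real n * (\<integral>x. f x - 1 \<partial>M)"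
proof -
  have "integrable M (\<lambda>x. F n x - 1) \<and> (\<integral>x. F n x - 1 \<partial>M) = real n * (\<integral>x. f x - 1 \<partial>M)"
  proof (induction n)
    case (Suc n)
    have eq: "F (Suc n) x - 1 = f x * (F n (R x) - 1) + (f x - 1)" for x
      by (simp add: algebra_simps)
    have I: "integrable M (\<lambda>x. F n x - 1)" using Suc by simp
    show ?case unfolding eq
      by (subst Bochner_Integration.integral_add[OF integrable_transfer[OF I] f_integrable])
        (simp add: Suc integral_transfer[OF I] distrib_right,
         rule Bochner_Integration.integrable_add[OF integrable_transfer[OF I] f_integrable])
  qed simp
  then show "integrable M (\<lambda>x. F n x - 1)"
    and "(\<integral>x. F n x - 1 \<partial>M) = real n * (\<integral>x. f x - 1 \<partial>M)" by auto
qed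

lemma
  assumes D [measurable]: "D \<in> sets M" and fin: "emeasure M D < \<infinity>"
  shows F_integrable_on: "integrable M (\<lambda>x. F n x * indicator D x)"
    and emeasure_funpow: "emeasure M ((T ^^ n) -` D \<inter> space M) = ennreal (\<integral>x. F n x * indicator D x \<partial>M)"
    and measure_funpow: "measure M ((T ^^ n) -` D \<inter> space M) = (\<integral>x. F n x * indicator D x \<partial>M)"
proof -
  have "integrable M (\<lambda>x. (F n x - 1) * indicator D x + indicator D x)"
    using F_integrable[of n] fin by (intro Bochner_Integration.integrable_add integrable_real_mult_indicator) auto
  then show I: "integrable M (\<lambda>x. F n x * indicator D x)" by (simp add: algebra_simps)
  have Tn [measurable]: "T ^^ n \<in> M \<rightarrow>\<^sub>M M" by (rule measurable_funpow[OF T])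
  have "emeasure M ((T ^^ n) -` D \<inter> space M) = emeasure (distr M M (T ^^ n)) D"
    by (simp add: emeasure_distr)
  also have "\<dots> = (\<integral>\<^sup>+x. ennreal (F n x * indicator D x) \<partial>M)"
    unfolding distr_funpow by (subst emeasure_density) (auto intro!: nn_integral_cong split: split_indicator)
  also have "\<dots> = ennreal (\<integral>x. F n x * indicator D x \<partial>M)"
    by (rule nn_integral_eq_integral[OF I]) (auto simp: F_nonneg)
  finally show E: "emeasure M ((T ^^ n) -` D \<inter> space M) = ennreal (\<integral>x. F n x * indicator D x \<partial>M)" .
  show "measure M ((T ^^ n) -` D \<inter> space M) = (\<integral>x. F n x * indicator D x \<partial>M)"
    unfolding measure_def E by (rule enn2real_ennreal) (auto simp: F_nonneg)
qed

end

section \<open>Truncating the densities near 1\<close>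

definition clamp1 :: "real \<Rightarrow> real \<Rightarrow> real" where
  "clamp1 e y = max (- e) (min e (y - 1))"

lemma clamp1_measurable [measurable]: "clamp1 e \<in> borel_measurable borel"
  unfolding clamp1_def by measurable

lemma abs_clamp1_le: "0 \<le> e \<Longrightarrow> \<bar>clamp1 e y\<bar> \<le> e" "0 \<le> e \<Longrightarrow> \<bar>clamp1 e y\<bar> \<le> \<bar>y - 1\<bar>"
  by (auto simp: clamp1_def)

text \<open>The clamp only reacts to arguments in \<open>[1 - e, 1 + e]\<close>, hence at most 2,
  and there multiplication by \<open>f\<close> moves a point by at most
  \<open>2 * \<bar>f - 1\<bar>\<close>. The other bound holds because both values lie in
  \<open>[- e, e]\<close>.\<close>

lemma clamp1_mult:
  assumes e: "0 \<le> e" "e \<le> 1" and fu: "0 \<le> f" "0 \<le> u"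
  shows "\<bar>clamp1 e (f * u) - clamp1 e u\<bar> \<le> min (2 * e) (2 * \<bar>f - 1\<bar>)"
proof -
  have "\<bar>clamp1 e (f * u) - clamp1 e u\<bar> \<le> 2 * \<bar>f - 1\<bar>"
  proof -
    \<comment> \<open>The point of \<open>[1 - e, 1 + e]\<close> nearest to \<open>u\<close>.
      Replacing \<open>u\<close> by \<open>c\<close> keeps the clamped value, and the change caused
      by the factor \<open>f\<close> is at most the displacement of \<open>c\<close>.\<close>
    define c where "c = max (1 - e) (min (1 + e) u)"
    have c: "0 \<le> c" "c \<le> 2" using e by (auto simp: c_def)
    have cu: "clamp1 e u = c - 1" by (auto simp: clamp1_def c_def)
    have "\<bar>f - 1\<bar> * c \<le> \<bar>f - 1\<bar> * 2" using c by (intro mult_left_mono) auto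
    moreover have "\<bar>clamp1 e (f * u) - clamp1 e u\<bar> \<le> \<bar>f * c - c\<bar>"
    proof (cases "u \<le> c")
      case True
      have "u < c \<Longrightarrow> c = 1 - e" "u < c \<or> u = c" using True e by (auto simp: c_def)
      moreover have "f * u \<le> f * c" using True fu by (intro mult_left_mono) auto
      moreover have "1 - e \<le> c" "c \<le> 1 + e" using e by (auto simp: c_def)
      ultimately show ?thesis unfolding cu by (auto simp: clamp1_def)
    next
      case False
      then have "c = 1 + e" using e by (auto simp: c_def split: if_splits)
      moreover have "f * c \<le> f * u" using False fu by (intro mult_left_mono) auto
      ultimately show ?thesis unfolding cu using e by (auto simp: clamp1_def)
    qed
    moreover have "\<bar>f * c - c\<bar> = \<bar>f - 1\<bar> * c"
    proof -
      have "f * c - c = (f - 1) * c" by (simp add: algebra_simps)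
      then show ?thesis using c by (simp add: abs_mult)
    qed
    ultimately show ?thesis by linarith
  qed
  moreover have "\<bar>clamp1 e (f * u) - clamp1 e u\<bar> \<le> 2 * e"
    using abs_clamp1_le(1)[OF e(1), of "f * u"] abs_clamp1_le(1)[OF e(1), of u] by linarith
  ultimately show ?thesis by simp
qed

context integrable_cocycle
begin

lemma clamp1_F_integrable: "0 \<le> e \<Longrightarrow> integrable M (\<lambda>x. clamp1 e (F n x))"
  by (rule Bochner_Integration.integrable_bound[OF F_integrable[of n]]) (auto simp: abs_clamp1_le)

text \<open>The transfer operator preserves integrals, so one step changes the integral by that of
  \<open>?h\<close>, the failure of clamping to commute with transfer. The term
  \<open>e * \<bar>f x - 1\<bar>\<close> pays for the weight \<open>f\<close> in front of a clamped
  value, the minimum for the factor \<open>f\<close> inside the clamp.\<close>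

lemma clamp1_F_integral:
  assumes e: "0 \<le> e" "e \<le> 1"
  shows "\<bar>\<integral>x. clamp1 e (F n x) \<partial>M\<bar> \<le>
    real n * (\<integral>x. e * \<bar>f x - 1\<bar> + min (2 * e) (2 * \<bar>f x - 1\<bar>) \<partial>M)"
proof (induction n)
  case 0
  show ?case using e by (simp add: clamp1_def)
next
  case (Suc n)
  let ?d = "\<lambda>x. e * \<bar>f x - 1\<bar> + min (2 * e) (2 * \<bar>f x - 1\<bar>)"
  let ?h = "\<lambda>x. clamp1 e (F (Suc n) x) - f x * clamp1 e (F n (R x))"
  note I = clamp1_F_integrable[OF e(1), of n]
  note J = clamp1_F_integrable[OF e(1), of "Suc n"]
  have h: "integrable M ?h" by (intro Bochner_Integration.integrable_diff J integrable_transfer[OF I])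
  have d: "integrable M ?d"
    by (rule Bochner_Integration.integrable_bound[OF integrable_mult_right[OF integrable_abs[OF f_integrable], of "e + 2"]])
      (use e in \<open>auto simp: algebra_simps\<close>)
  have hd: "\<bar>?h x\<bar> \<le> ?d x" for x
  proof -
    have "?h x = (clamp1 e (f x * F n (R x)) - clamp1 e (F n (R x))) - clamp1 e (F n (R x)) * (f x - 1)"
      by (simp add: algebra_simps)
    moreover have "\<bar>clamp1 e (F n (R x)) * (f x - 1)\<bar> \<le> e * \<bar>f x - 1\<bar>"
      unfolding abs_mult using e by (intro mult_right_mono abs_clamp1_le) auto
    ultimately show ?thesis
      using clamp1_mult[OF e f_nonneg F_nonneg, of x n "R x"] by linarith
  qed
  have "(\<integral>x. clamp1 e (F (Suc n) x) \<partial>M) = (\<integral>x. ?h x \<partial>M) + (\<integral>x. clamp1 e (F n x) \<partial>M)"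
    using integral_transfer[OF I] by (subst Bochner_Integration.integral_diff[OF J integrable_transfer[OF I]]) simp
  moreover have "\<bar>\<integral>x. ?h x \<partial>M\<bar> \<le> (\<integral>x. ?d x \<partial>M)"
    by (rule order_trans[OF integral_abs_bound]) (intro integral_mono integrable_abs h d hd)
  ultimately have "\<bar>\<integral>x. clamp1 e (F (Suc n) x) \<partial>M\<bar> \<le> (\<integral>x. ?d x \<partial>M) + real n * (\<integral>x. ?d x \<partial>M)"
    using Suc by linarith
  then show ?case by (simp add: algebra_simps)
qed

text \<open>Dominated convergence along \<open>e = 1 / Suc k\<close>. The bound \<open>2 * e\<close>
  alone makes the integrand small but may not be integrable; the alternative
  \<open>2 * \<bar>f x - 1\<bar>\<close> in the minimum supplies the dominating function.\<close>

lemma ex_small_clamp: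
  assumes "0 < c"
  obtains e where "0 < e" "e \<le> 1" "(\<integral>x. e * \<bar>f x - 1\<bar> + min (2 * e) (2 * \<bar>f x - 1\<bar>) \<partial>M) < c"
proof -
  let ?s = "\<lambda>k x. (1 / real (Suc k)) * \<bar>f x - 1\<bar> + min (2 * (1 / real (Suc k))) (2 * \<bar>f x - 1\<bar>)"
  have lim: "(\<lambda>k. 1 / real (Suc k)) \<longlonglongrightarrow> 0" using LIMSEQ_inverse_real_of_nat by (simp add: inverse_eq_divide)
  have "(\<lambda>k. \<integral>x. ?s k x \<partial>M) \<longlonglongrightarrow> (\<integral>x. 0 \<partial>M)"
  proof (rule integral_dominated_convergence[where w = "\<lambda>x. 3 * \<bar>f x - 1\<bar>"])
    show "AE x in M. (\<lambda>k. ?s k x) \<longlonglongrightarrow> 0"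
    proof (rule AE_I2)
      fix x
      have "(\<lambda>k. ?s k x) \<longlonglongrightarrow> 0 * \<bar>f x - 1\<bar> + min (2 * 0) (2 * \<bar>f x - 1\<bar>)"
        by (intro tendsto_add tendsto_mult tendsto_min lim tendsto_const)
      then show "(\<lambda>k. ?s k x) \<longlonglongrightarrow> 0" by simp
    qed
    show "AE x in M. norm (?s k x) \<le> 3 * \<bar>f x - 1\<bar>" for k
    proof (rule AE_I2)
      fix x
      have "(1 / real (Suc k)) * \<bar>f x - 1\<bar> \<le> 1 * \<bar>f x - 1\<bar>" by (intro mult_right_mono) auto
      moreover have "0 \<le> (1 / real (Suc k)) * \<bar>f x - 1\<bar>" "0 \<le> 1 / real (Suc k)" by auto
      ultimately show "norm (?s k x) \<le> 3 * \<bar>f x - 1\<bar>" unfolding real_norm_def by linarith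
    qed
  qed (use f_integrable in auto)
  then have "(\<lambda>k. \<integral>x. ?s k x \<partial>M) \<longlonglongrightarrow> 0" by simp
  then have "eventually (\<lambda>k. (\<integral>x. ?s k x \<partial>M) < c) sequentially" using assms by (rule order_tendstoD)
  then obtain k where "(\<integral>x. ?s k x \<partial>M) < c" by (auto simp: eventually_sequentially)
  then show thesis by (intro that[of "1 / real (Suc k)"]) auto
qed

text \<open>The integral of \<open>F n - 1\<close> grows linearly, while by the previous lemmas truncating
  \<open>F n - 1\<close> at a small level \<open>e\<close> makes its integral grow at a much smaller rate. So the set where
  \<open>F n - 1\<close> exceeds \<open>e\<close> in the direction of its integral carries a linear share of it.\<close>

lemma linear_gap:
  assumes chi: "(\<integral>x. f x - 1 \<partial>M) \<noteq> 0"
  obtains e c where "0 < e" "0 < c"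
    "\<And>n. \<exists>D\<in>sets M. emeasure M D < \<infinity> \<and>
      ((1 + e) * measure M D + c * real n \<le> measure M ((T ^^ n) -` D \<inter> space M) \<or>
       (1 + e) * measure M ((T ^^ n) -` D \<inter> space M) + c * real n \<le> measure M D)"
proof -
  define X where "X = (\<integral>x. f x - 1 \<partial>M)"
  \<comment> \<open>The clamped part may consume half of the growth rate; the other half remains for
    the gap.\<close>
  define c where "c = \<bar>X\<bar> / 2"
  have c: "c > 0" using chi by (simp add: c_def X_def)
  obtain e where e: "0 < e" "e \<le> 1"
    and small: "(\<integral>x. e * \<bar>f x - 1\<bar> + min (2 * e) (2 * \<bar>f x - 1\<bar>) \<partial>M) < c"
    using ex_small_clamp[OF c] .
  have "\<exists>D\<in>sets M. emeasure M D < \<infinity> \<and>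
      ((1 + e) * measure M D + c * real n \<le> measure M ((T ^^ n) -` D \<inter> space M) \<or>
       (1 + e) * measure M ((T ^^ n) -` D \<inter> space M) + c * real n \<le> measure M D)" for n
  proof -
    let ?G = "\<lambda>x. clamp1 e (F n x)"
    have G: "integrable M ?G" using e by (intro clamp1_F_integrable) auto
    have "\<bar>\<integral>x. ?G x \<partial>M\<bar> \<le> real n * c"
      using clamp1_F_integral[of e n] e small
      by (intro order_trans[OF clamp1_F_integral] mult_left_mono) auto
    then have r: "\<bar>(\<integral>x. (F n x - 1) - ?G x \<partial>M) - real n * X\<bar> \<le> real n * c"
      by (subst Bochner_Integration.integral_diff[OF F_integrable G]) (simp add: F_integral X_def)
    \<comment> \<open>Markov's inequality for the integrable function
      \<open>F n - 1\<close>.\<close>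
    have fin: "emeasure M D < \<infinity>" if D: "D \<in> sets M" "\<And>x. x \<in> D \<Longrightarrow> e \<le> \<bar>F n x - 1\<bar>" for D
    proof -
      have "integrable M (\<lambda>x. indicator D x :: real)"
      proof (rule Bochner_Integration.integrable_bound[OF integrable_mult_right[OF integrable_abs[OF F_integrable[of n]], of "1 / e"]])
        show "AE x in M. norm (indicator D x :: real) \<le> norm (1 / e * \<bar>F n x - 1\<bar>)"
          using D(2) e by (auto simp: indicator_def field_simps)
      qed (use D in auto)
      then show ?thesis using D by (simp add: integrable_indicator_iff)
    qed
    have I: "integrable M (\<lambda>x. F n x * indicator D x - b * indicator D x)"
      and E: "(\<integral>x. F n x * indicator D x - b * indicator D x \<partial>M) =
        measure M ((T ^^ n) -` D \<inter> space M) - b * measure M D"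
      if D: "D \<in> sets M" "emeasure M D < \<infinity>" for D b
    proof -
      have J: "integrable M (\<lambda>x. b * indicator D x :: real)" using D by auto
      show "integrable M (\<lambda>x. F n x * indicator D x - b * indicator D x)"
        using F_integrable_on[OF D] J by auto
      show "(\<integral>x. F n x * indicator D x - b * indicator D x \<partial>M) =
          measure M ((T ^^ n) -` D \<inter> space M) - b * measure M D"
        using F_integrable_on[OF D] J D
        by (subst Bochner_Integration.integral_diff) (auto simp: measure_funpow[OF D])
    qed
    have FG: "integrable M (\<lambda>x. (F n x - 1) - ?G x)" using F_integrable[of n] G by auto
    show ?thesis
    proof (cases "X > 0")
      case True
      \<comment> \<open>On \<open>D\<close> the part left after clamping is
        \<open>F n x - (1 + e)\<close>; off \<open>D\<close> it is at most 0. So its integral is at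
        most the difference evaluated by \<open>E\<close>.\<close>
      define D where "D = {x \<in> space M. F n x > 1 + e}"
      have D: "D \<in> sets M" unfolding D_def by measurable
      have Df: "emeasure M D < \<infinity>" by (rule fin[OF D]) (auto simp: D_def)
      have "(\<integral>x. (F n x - 1) - ?G x \<partial>M) \<le>
          (\<integral>x. F n x * indicator D x - (1 + e) * indicator D x \<partial>M)"
        by (rule integral_mono[OF FG I[OF D Df]]) (use e in \<open>auto simp: D_def clamp1_def split: split_indicator\<close>)
      also have "\<dots> = measure M ((T ^^ n) -` D \<inter> space M) - (1 + e) * measure M D" by (rule E[OF D Df])
      finally have "measure M ((T ^^ n) -` D \<inter> space M) - (1 + e) * measure M D \<ge> real n * X - real n * c"
        using r by linarith
      moreover have "real n * X - real n * c = c * real n" using True by (simp add: c_def field_simps)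
      ultimately show ?thesis using D Df by (intro bexI[of _ D]) auto
    next
      case False
      \<comment> \<open>Mirror image: on \<open>D\<close> the remaining part is
        \<open>F n x - (1 - e)\<close>, and off \<open>D\<close> it is at least 0.\<close>
      define D where "D = {x \<in> space M. F n x < 1 - e}"
      let ?a = "measure M D" and ?b = "measure M ((T ^^ n) -` D \<inter> space M)"
      have D: "D \<in> sets M" unfolding D_def by measurable
      have Df: "emeasure M D < \<infinity>" by (rule fin[OF D]) (use e in \<open>auto simp: D_def\<close>)
      have "?b - (1 - e) * ?a = (\<integral>x. F n x * indicator D x - (1 - e) * indicator D x \<partial>M)"
        by (rule E[OF D Df, symmetric])
      also have "\<dots> \<le> (\<integral>x. (F n x - 1) - ?G x \<partial>M)"
        by (rule integral_mono[OF I[OF D Df] FG]) (use e in \<open>auto simp: D_def clamp1_def split: split_indicator\<close>)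
      also have "\<dots> \<le> real n * X + real n * c" using r by linarith
      also have "\<dots> = - c * real n" using False by (simp add: c_def field_simps)
      finally have "?b + c * real n \<le> (1 - e) * ?a" by simp
      \<comment> \<open>Since \<open>(1 + e) * (1 - e) \<le> 1\<close>, the factor
        \<open>1 - e\<close> on one side becomes the required factor \<open>1 + e\<close> on the
        other.\<close>
      then have "(1 + e) * (?b + c * real n) \<le> (1 + e) * ((1 - e) * ?a)"
        using e by (intro mult_left_mono) auto
      also have "\<dots> \<le> ?a"
      proof -
        have "(1 + e) * ((1 - e) * ?a) = ?a - (e * e) * ?a" by (simp add: algebra_simps)
        then show ?thesis by simp
      qed
      finally have "(1 + e) * ?b + (1 + e) * (c * real n) \<le> ?a" by (simp add: algebra_simps)
      moreover have "1 * (c * real n) \<le> (1 + e) * (c * real n)" using e c by (intro mult_right_mono) auto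
      ultimately have "(1 + e) * ?b + c * real n \<le> ?a" by linarith
      then show ?thesis using D Df by (intro bexI[of _ D]) auto
    qed
  qed
  then show thesis using that e c by blast
qed

end

section \<open>Nonsingularity of the suspension\<close>

text \<open>A single approximant must serve both measures, because \<open>P\<close> is going to be
  compared with its image law on the same event.\<close>

lemma measure_symdiff_approx:
  assumes alg: "algebra \<Omega> \<A>" and N: "finite_measure N" "finite_measure N'"
    and sets: "sets N = sigma_sets \<Omega> \<A>" "sets N' = sigma_sets \<Omega> \<A>"
    and E: "E \<in> sigma_sets \<Omega> \<A>" and "0 < (\<eta>::real)"
  shows "\<exists>A\<in>\<A>. measure N ((E - A) \<union> (A - E)) + measure N' ((E - A) \<union> (A - E)) < \<eta>"
  using E \<open>0 < \<eta>\<close>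
proof (induction arbitrary: \<eta>)
  interpret algebra \<Omega> \<A> by fact
  case (Basic A)
  then show ?case by (intro bexI[of _ A]) auto
next
  interpret algebra \<Omega> \<A> by fact
  case Empty
  then show ?case by (intro bexI[of _ "{}"]) auto
next
  interpret algebra \<Omega> \<A> by fact
  case (Compl E)
  obtain A where A: "A \<in> \<A>" "measure N ((E - A) \<union> (A - E)) + measure N' ((E - A) \<union> (A - E)) < \<eta>"
    using Compl by blast
  have "E \<subseteq> \<Omega>" using Compl.hyps by (meson sigma_sets_into_sp space_closed)
  then have "(\<Omega> - E - (\<Omega> - A)) \<union> (\<Omega> - A - (\<Omega> - E)) = (E - A) \<union> (A - E)"
    using A(1) sets_into_space by blast
  then show ?case using A by (intro bexI[of _ "\<Omega> - A"]) auto
next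
  interpret algebra \<Omega> \<A> by fact
  interpret N: finite_measure N by fact
  interpret N': finite_measure N' by fact
  case (Union E)
  let ?\<rho> = "\<lambda>X. measure N X + measure N' X"
  let ?D = "\<lambda>n. (\<Union>i. E i) - (\<Union>i<n. E i)"
  have E [measurable]: "E i \<in> sets N" "E i \<in> sets N'" for i using Union.hyps sets by auto
  have D0: "(\<Inter>n. ?D n) = {}" by auto
  have "decseq ?D" by (auto simp: decseq_def)
  then have "(\<lambda>n. ?\<rho> (?D n)) \<longlonglongrightarrow> measure N (\<Inter>n. ?D n) + measure N' (\<Inter>n. ?D n)"
    by (intro tendsto_add N.finite_Lim_measure_decseq N'.finite_Lim_measure_decseq) auto
  then have "(\<lambda>n. ?\<rho> (?D n)) \<longlonglongrightarrow> 0" unfolding D0 by simp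
  then have "eventually (\<lambda>n. ?\<rho> (?D n) < \<eta> / 2) sequentially"
    by (rule order_tendstoD) (use Union.prems in simp)
  then obtain n where n: "?\<rho> (?D n) < \<eta> / 2" by (auto simp: eventually_sequentially)
  \<comment> \<open>\<open>Suc n\<close> instead of \<open>n\<close> avoids division by zero when no
    set is kept; the tail and the \<open>n\<close> approximations each cost at most half of
    \<open>\<eta>\<close>.\<close>
  define \<epsilon> where "\<epsilon> = \<eta> / (2 * real (Suc n))"
  have "\<epsilon> > 0" using Union.prems by (simp add: \<epsilon>_def)
  then have "\<forall>i. \<exists>A\<in>\<A>. ?\<rho> ((E i - A) \<union> (A - E i)) < \<epsilon>" using Union.IH by blast
  then obtain A where A: "\<And>i. A i \<in> \<A>" "\<And>i. ?\<rho> ((E i - A i) \<union> (A i - E i)) < \<epsilon>" by metis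
  have [measurable]: "A i \<in> sets N" "A i \<in> sets N'" for i using A(1) sets by auto
  let ?A = "\<Union>i<n. A i" and ?S = "\<lambda>i. (E i - A i) \<union> (A i - E i)"
  have sub: "((\<Union>i. E i) - ?A) \<union> (?A - (\<Union>i. E i)) \<subseteq> ?D n \<union> (\<Union>i<n. ?S i)" by blast
  have "measure N (((\<Union>i. E i) - ?A) \<union> (?A - (\<Union>i. E i))) \<le> measure N (?D n \<union> (\<Union>i<n. ?S i))"
    by (rule N.finite_measure_mono[OF sub]) auto
  also have "\<dots> \<le> measure N (?D n) + measure N (\<Union>i<n. ?S i)" by (rule measure_Un_le) auto
  also have "measure N (\<Union>i<n. ?S i) \<le> (\<Sum>i<n. measure N (?S i))" by (rule measure_UNION_le) auto
  finally have 1: "measure N (((\<Union>i. E i) - ?A) \<union> (?A - (\<Union>i. E i))) \<le>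
      measure N (?D n) + (\<Sum>i<n. measure N (?S i))" by simp
  have "measure N' (((\<Union>i. E i) - ?A) \<union> (?A - (\<Union>i. E i))) \<le> measure N' (?D n \<union> (\<Union>i<n. ?S i))"
    by (rule N'.finite_measure_mono[OF sub]) auto
  also have "\<dots> \<le> measure N' (?D n) + measure N' (\<Union>i<n. ?S i)" by (rule measure_Un_le) auto
  also have "measure N' (\<Union>i<n. ?S i) \<le> (\<Sum>i<n. measure N' (?S i))" by (rule measure_UNION_le) auto
  finally have 2: "measure N' (((\<Union>i. E i) - ?A) \<union> (?A - (\<Union>i. E i))) \<le>
      measure N' (?D n) + (\<Sum>i<n. measure N' (?S i))" by simp
  have "(\<Sum>i<n. measure N (?S i)) + (\<Sum>i<n. measure N' (?S i)) \<le> (\<Sum>i<n. \<epsilon>)"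
    unfolding sum.distrib[symmetric] using A(2) by (intro sum_mono) (simp add: less_imp_le)
  also have "\<dots> \<le> \<eta> / 2" using Union.prems by (simp add: \<epsilon>_def field_simps)
  finally have "?\<rho> (((\<Union>i. E i) - ?A) \<union> (?A - (\<Union>i. E i))) < \<eta>" using 1 2 n by linarith
  moreover have "?A \<in> \<A>" using A(1) by auto
  ultimately show ?case by blast
qed

text \<open>The cells are the atoms of the generated algebra, one for each nonempty subfamily. The
  empty subfamily is left out, since its cell may have infinite measure. Padding with empty sets
  produces the sequence that independence in \<open>poisson_law\<close> speaks about.\<close>

lemma finite_disjoint_refinement:
  assumes fin: "finite \<C>" and \<C>: "\<And>A. A \<in> \<C> \<Longrightarrow> A \<in> sets M \<and> emeasure M A < \<infinity>"
  obtains C :: "nat \<Rightarrow> 'a set" and k where "disjoint_family C"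
    "\<And>i. C i \<in> sets M" "\<And>i. emeasure M (C i) < \<infinity>"
    "\<And>A. A \<in> \<C> \<Longrightarrow> \<exists>J\<subseteq>{..k}. A = (\<Union>i\<in>J. C i)"
proof -
  have "finite (Pow \<C>)" using fin by simp
  then obtain g where g: "bij_betw g {0..<card (Pow \<C>)} (Pow \<C>)"
    using ex_bij_betw_nat_finite by blast
  let ?k = "card (Pow \<C>)"
  define C where "C i = (if i < ?k \<and> g i \<noteq> {} then \<Inter>(g i) - \<Union>(\<C> - g i) else {})" for i
  have gsub: "g i \<subseteq> \<C>" if "i < ?k" for i
    using bij_betwE[OF g] that by auto
  have Cs: "C i \<in> sets M \<and> emeasure M (C i) < \<infinity>" for i
  proof (cases "i < ?k \<and> g i \<noteq> {}")
    case True
    then obtain A where A: "A \<in> g i" by auto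
    have s: "g i \<subseteq> \<C>" "finite (g i)" using True gsub[of i] finite_subset[OF _ fin] by auto
    have "\<Inter>(g i) \<in> sets M" using True s \<C> sets.finite_INT[of "g i" "\<lambda>B. B" M] by auto
    moreover have "\<Union>(\<C> - g i) \<in> sets M" using fin \<C> by (intro sets.finite_Union) auto
    ultimately have Ci: "C i \<in> sets M" using True by (auto simp: C_def)
    have "C i \<subseteq> A" using A True by (auto simp: C_def)
    then have "emeasure M (C i) \<le> emeasure M A" using A s \<C> by (intro emeasure_mono) auto
    also have "\<dots> < \<infinity>" using A s \<C> by auto
    finally show ?thesis using Ci by simp
  next
    case False
    then have "C i = {}" unfolding C_def by (rule if_not_P)
    then show ?thesis by simp
  qed
  have "disjoint_family C"
  proof (unfold disjoint_family_on_def, intro ballI impI)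
    fix i j :: nat assume "i \<noteq> j"
    show "C i \<inter> C j = {}"
    proof (cases "i < ?k \<and> j < ?k")
      case True
      then have "g i \<noteq> g j" using g \<open>i \<noteq> j\<close> by (auto simp: bij_betw_def inj_on_def)
      then obtain A where "A \<in> g i \<and> A \<notin> g j \<or> A \<in> g j \<and> A \<notin> g i" by blast
      then show ?thesis using gsub[of i] gsub[of j] True by (auto simp: C_def)
    qed (auto simp: C_def)
  qed
  moreover have "\<exists>J\<subseteq>{..?k}. A = (\<Union>i\<in>J. C i)" if A: "A \<in> \<C>" for A
  proof (intro exI conjI)
    let ?J = "{i. i < ?k \<and> A \<in> g i}"
    show "?J \<subseteq> {..?k}" by auto
    show "A = (\<Union>i\<in>?J. C i)"
    proof (intro equalityI subsetI)
      fix x assume x: "x \<in> A"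
      let ?S = "{B \<in> \<C>. x \<in> B}"
      obtain i where i: "i < ?k" "g i = ?S"
        using g unfolding bij_betw_def by (metis (no_types, lifting) PowI atLeastLessThan_iff imageE mem_Collect_eq subsetI)
      then have "x \<in> C i" using x A by (auto simp: C_def)
      then show "x \<in> (\<Union>i\<in>?J. C i)" using i x A by auto
    qed (auto simp: C_def split: if_splits)
  qed
  ultimately show thesis using that Cs by blast
qed

section \<open>Comparing Poisson laws on finitely many counts\<close>

context poisson_process
begin

lemma prob_joint:
  fixes n :: "nat \<Rightarrow> nat"
  assumes C: "disjoint_family C" "\<And>i. C i \<in> sets M" "\<And>i. emeasure M (C i) < \<infinity>"
  shows "prob {w \<in> space P. \<forall>i\<le>k. emeasure w (C i) = of_nat (n i)} =
    (\<Prod>i\<le>k. measure M (C i) ^ n i / fact (n i) * exp (- measure M (C i)))"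
proof -
  have ind: "indep_vars (\<lambda>_. borel) (\<lambda>i w. emeasure w (C i)) UNIV"
    using law C unfolding poisson_law_def by blast
  have "{w \<in> space P. \<forall>i\<le>k. emeasure w (C i) = of_nat (n i)} =
      (\<Inter>i\<in>{..k}. (\<lambda>w. emeasure w (C i)) -` {of_nat (n i)} \<inter> space P)"
    by auto
  also have "prob \<dots> = (\<Prod>i\<le>k. prob ((\<lambda>w. emeasure w (C i)) -` {of_nat (n i)} \<inter> space P))"
    by (rule indep_varsD[OF ind]) auto
  also have "\<dots> = (\<Prod>i\<le>k. prob {w \<in> space P. emeasure w (C i) = of_nat (n i)})"
    by (intro prod.cong refl arg_cong[where f = prob]) auto
  finally show ?thesis using prob_eq[OF C(2,3)] by simp
qed

lemma nn_integral_prod_power_cnt: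
  assumes C: "disjoint_family C" "\<And>i::nat. C i \<in> sets M" "\<And>i. emeasure M (C i) < \<infinity>"
    and r: "\<And>i. 0 \<le> r i"
  shows "(\<integral>\<^sup>+w. (\<Prod>i\<le>k. ennreal (r i ^ cnt (C i) w)) \<partial>P) =
    ennreal (exp (\<Sum>i\<le>k. measure M (C i) * (r i - 1)))"
proof -
  have "indep_vars (\<lambda>_. borel) (\<lambda>i w. ennreal (r i ^ cnt (C i) w)) UNIV"
    using indep_vars_cnt[OF C] by (rule indep_vars_compose2) auto
  then have "(\<integral>\<^sup>+w. (\<Prod>i\<le>k. ennreal (r i ^ cnt (C i) w)) \<partial>P) =
      (\<Prod>i\<le>k. \<integral>\<^sup>+w. ennreal (r i ^ cnt (C i) w) \<partial>P)"
    by (intro indep_vars_nn_integral) (auto intro: indep_vars_subset)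
  also have "\<dots> = (\<Prod>i\<le>k. ennreal (exp (measure M (C i) * (r i - 1))))"
    by (intro prod.cong refl nn_integral_power_cnt C r)
  also have "\<dots> = ennreal (exp (\<Sum>i\<le>k. measure M (C i) * (r i - 1)))"
    by (subst prod_ennreal) (auto simp: exp_sum)
  finally show ?thesis .
qed

text \<open>Here \<open>N\<close> is the Poisson law on the counts of \<open>C 0, \<dots>, C k\<close> in which the intensity of
  \<open>C i\<close> is multiplied by \<open>r i\<close>. The image of \<open>P\<close> under the suspension has larger intensities, so
  it dominates \<open>exp (- \<delta>) N\<close>; taking complements turns this into an upper bound. The density of
  \<open>N\<close> has second moment at most \<open>exp V\<close>.\<close>

lemma suspension_prob_le:
  assumes T: "T \<in> M \<rightarrow>\<^sub>M M"
    and C: "disjoint_family C" "\<And>i::nat. C i \<in> sets M" "\<And>i. emeasure M (C i) < \<infinity>"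
    and TC: "\<And>i. emeasure M (T -` C i \<inter> space M) < \<infinity>"
    and r: "\<And>i. 0 \<le> r i"
    and le: "\<And>i. measure M (C i) * r i \<le> measure M (T -` C i \<inter> space M)"
    and \<delta>: "(\<Sum>i\<le>k. measure M (T -` C i \<inter> space M) - measure M (C i) * r i) \<le> \<delta>"
    and V: "(\<Sum>i\<le>k. measure M (C i) * (r i - 1)\<^sup>2) \<le> V"
    and E: "E \<in> sets P"
    and det: "\<And>w w'. w \<in> space P \<Longrightarrow> w' \<in> space P \<Longrightarrow>
      (\<And>i. i \<le> k \<Longrightarrow> emeasure w (C i) = emeasure w' (C i)) \<Longrightarrow> w \<in> E \<longleftrightarrow> w' \<in> E"
    and "0 < \<mu>"
  shows "prob (suspension M T -` E \<inter> space P) \<le> \<delta> + \<mu> * prob E + exp V / \<mu>"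
proof -
  note [measurable] = C(2)
  define S where "S = suspension M T"
  have S [measurable]: "S \<in> P \<rightarrow>\<^sub>M P" unfolding S_def by (rule suspension_measurable[OF T])
  let ?a = "\<lambda>i. measure M (C i)" and ?b = "\<lambda>i. measure M (T -` C i \<inter> space M)"
  let ?c = "exp (\<Sum>i\<le>k. ?a i - ?a i * r i)"
  \<comment> \<open>The likelihood ratio of independent Poisson counts with means
    \<open>?a i * r i\<close> against those with means \<open>?a i\<close>.\<close>
  define L where "L w = ?c * (\<Prod>i\<le>k. r i ^ cnt (C i) w)" for w
  have L0: "0 \<le> L w" for w by (auto simp: L_def r intro!: mult_nonneg_nonneg prod_nonneg)
  have L_meas [measurable]: "L \<in> borel_measurable P" unfolding L_def by measurable
  define N where "N = density P (\<lambda>w. ennreal (L w))"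
  have sets_N [measurable_cong]: "sets N = sets P" by (simp add: N_def)
  have int_L: "(\<integral>\<^sup>+w. ennreal (L w) \<partial>P) = 1"
  proof -
    have "(\<integral>\<^sup>+w. ennreal (L w) \<partial>P) = (\<integral>\<^sup>+w. ennreal ?c * (\<Prod>i\<le>k. ennreal (r i ^ cnt (C i) w)) \<partial>P)"
      by (intro nn_integral_cong) (simp add: L_def ennreal_mult prod_ennreal prod_nonneg r)
    also have "\<dots> = ennreal ?c * ennreal (exp (\<Sum>i\<le>k. ?a i * (r i - 1)))"
      by (subst nn_integral_cmult) (auto simp: nn_integral_prod_power_cnt[OF C r])
    also have "\<dots> = 1"
      by (simp add: ennreal_mult[symmetric] mult_exp_exp sum.distrib[symmetric] algebra_simps)
    finally show ?thesis .
  qed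
  have int_L2: "(\<integral>\<^sup>+w. ennreal ((L w)\<^sup>2) \<partial>P) \<le> ennreal (exp V)"
  proof -
    have "(L w)\<^sup>2 = ?c\<^sup>2 * (\<Prod>i\<le>k. ((r i)\<^sup>2) ^ cnt (C i) w)" for w
      unfolding L_def power_mult_distrib prod_power_distrib
      by (simp add: power_mult[symmetric] mult.commute)
    then have "(\<integral>\<^sup>+w. ennreal ((L w)\<^sup>2) \<partial>P) =
        (\<integral>\<^sup>+w. ennreal (?c\<^sup>2) * (\<Prod>i\<le>k. ennreal (((r i)\<^sup>2) ^ cnt (C i) w)) \<partial>P)"
      by (intro nn_integral_cong) (simp add: ennreal_mult prod_ennreal prod_nonneg r)
    also have "\<dots> = ennreal (?c\<^sup>2) * ennreal (exp (\<Sum>i\<le>k. ?a i * ((r i)\<^sup>2 - 1)))"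
      using nn_integral_prod_power_cnt[OF C, of "\<lambda>i. (r i)\<^sup>2" k]
      by (subst nn_integral_cmult) auto
    also have "\<dots> = ennreal (exp (2 * (\<Sum>i\<le>k. ?a i - ?a i * r i) + (\<Sum>i\<le>k. ?a i * ((r i)\<^sup>2 - 1))))"
      by (simp add: ennreal_mult[symmetric] mult_exp_exp exp_double[symmetric])
    also have "2 * (\<Sum>i\<le>k. ?a i - ?a i * r i) + (\<Sum>i\<le>k. ?a i * ((r i)\<^sup>2 - 1)) =
        (\<Sum>i\<le>k. ?a i * (r i - 1)\<^sup>2)"
      unfolding sum_distrib_left sum.distrib[symmetric]
      by (intro sum.cong refl) (simp add: power2_eq_square algebra_simps)
    also have "ennreal (exp \<dots>) \<le> ennreal (exp V)" using V by (intro ennreal_leI) simp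
    finally show ?thesis .
  qed
  interpret N: prob_space N
    by (rule prob_spaceI) (simp add: N_def emeasure_density int_L cong: nn_integral_cong)
  \<comment> \<open>Only a lower bound is available: raising a mean from \<open>?a i * r i\<close>
    to \<open>?b i\<close> decreases each Poisson weight by at most the factor
    \<open>exp (?a i * r i - ?b i)\<close>, whereas it may increase the weights by factors unbounded
    in the count.\<close>
  have lower: "exp (- \<delta>) * measure N G \<le> prob (S -` G \<inter> space P)"
    if G [measurable]: "G \<in> sets P" and Gdet: "\<And>w w'. w \<in> space P \<Longrightarrow> w' \<in> space P \<Longrightarrow>
      (\<And>i. i \<le> k \<Longrightarrow> emeasure w (C i) = emeasure w' (C i)) \<Longrightarrow> w \<in> G \<longleftrightarrow> w' \<in> G" for G
  proof -
    define Z where "Z n = {w \<in> space P. \<forall>i\<le>k. emeasure w (C i) = of_nat (n i)}" for n :: "nat \<Rightarrow> nat"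
    have Z [measurable]: "Z n \<in> sets P" for n unfolding Z_def by measurable
    \<comment> \<open>Up to a null set, \<open>G\<close> is the disjoint union of the countably many
      count patterns it contains. Extensional functions are used so that different indices differ at
      some \<open>i \<le> k\<close>.\<close>
    define J where "J = {n \<in> {..k} \<rightarrow>\<^sub>E (UNIV :: nat set). Z n \<subseteq> G}"
    have J: "countable J" unfolding J_def
      by (rule countable_subset[OF _ countable_PiE[of "{..k}" "\<lambda>_. UNIV"]]) auto
    have disj: "disjoint_family_on Z J"
    proof (unfold disjoint_family_on_def, intro ballI impI)
      fix m n assume mn: "m \<in> J" "n \<in> J" "m \<noteq> n"
      then obtain i where "m i \<noteq> n i" by auto
      moreover from this have "i \<le> k" using mn by (auto simp: J_def PiE_def extensional_def)
      ultimately show "Z m \<inter> Z n = {}" by (auto simp: Z_def)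
    qed
    have pt: "ennreal (exp (- \<delta>)) * emeasure N (Z n) \<le> emeasure P (S -` Z n \<inter> space P)" for n
    proof -
      have "emeasure N (Z n) = (\<integral>\<^sup>+w. ennreal (?c * (\<Prod>i\<le>k. r i ^ n i)) * indicator (Z n) w \<partial>P)"
        unfolding N_def
        by (subst emeasure_density) (auto intro!: nn_integral_cong prod.cong simp: L_def Z_def cnt_eqI split: split_indicator)
      also have "\<dots> = ennreal (?c * (\<Prod>i\<le>k. r i ^ n i)) * ennreal (prob (Z n))"
        by (subst nn_integral_cmult_indicator) (auto simp: emeasure_eq_measure)
      also have "\<dots> = ennreal (\<Prod>i\<le>k. (?a i * r i) ^ n i / fact (n i) * exp (- (?a i * r i)))"
      proof -
        have "?c * (\<Prod>i\<le>k. r i ^ n i) * prob (Z n) =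
            (\<Prod>i\<le>k. exp (?a i - ?a i * r i) * r i ^ n i * (?a i ^ n i / fact (n i) * exp (- ?a i)))"
          unfolding Z_def prob_joint[OF C] by (simp only: exp_sum[OF finite_atMost] prod.distrib)
        also have "\<dots> = (\<Prod>i\<le>k. (?a i * r i) ^ n i / fact (n i) * exp (- (?a i * r i)))"
          by (intro prod.cong refl) (simp add: power_mult_distrib exp_diff exp_minus field_simps)
        finally show ?thesis
          by (subst ennreal_mult[symmetric]) (auto intro!: mult_nonneg_nonneg prod_nonneg zero_le_power r)
      qed
      finally have N_Z: "emeasure N (Z n) = ennreal (\<Prod>i\<le>k. (?a i * r i) ^ n i / fact (n i) * exp (- (?a i * r i)))" .
      have "S -` Z n \<inter> space P = {w \<in> space P. \<forall>i\<le>k. emeasure w (T -` C i \<inter> space M) = of_nat (n i)}"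
        using emeasure_suspension[OF T _ C(2)] suspension_in_space[OF T]
        by (auto simp: S_def Z_def space_P)
      also have "prob \<dots> = (\<Prod>i\<le>k. ?b i ^ n i / fact (n i) * exp (- ?b i))"
        by (rule prob_joint) (use C T TC in \<open>auto simp: disjoint_family_on_def\<close>)
      finally have P_Z: "prob (S -` Z n \<inter> space P) = (\<Prod>i\<le>k. ?b i ^ n i / fact (n i) * exp (- ?b i))" .
      have "(\<Prod>i\<le>k. (?a i * r i) ^ n i / fact (n i) * exp (- (?a i * r i))) \<le>
          (\<Prod>i\<le>k. exp (?b i - ?a i * r i) * (?b i ^ n i / fact (n i) * exp (- ?b i)))"
      proof (intro prod_mono conjI)
        fix i
        have "(?a i * r i) ^ n i \<le> ?b i ^ n i" using le r by (intro power_mono) auto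
        then have "(?a i * r i) ^ n i / fact (n i) * exp (- (?a i * r i)) \<le>
            ?b i ^ n i / fact (n i) * exp (- (?a i * r i))"
          by (intro mult_right_mono divide_right_mono) auto
        also have "\<dots> = exp (?b i - ?a i * r i) * (?b i ^ n i / fact (n i) * exp (- ?b i))"
          by (simp add: exp_diff exp_minus field_simps)
        finally show "(?a i * r i) ^ n i / fact (n i) * exp (- (?a i * r i)) \<le>
          exp (?b i - ?a i * r i) * (?b i ^ n i / fact (n i) * exp (- ?b i))" .
      qed (use r in auto)
      also have "\<dots> = exp (\<Sum>i\<le>k. ?b i - ?a i * r i) * prob (S -` Z n \<inter> space P)"
        unfolding P_Z by (simp only: prod.distrib exp_sum[OF finite_atMost])
      also have "\<dots> \<le> exp \<delta> * prob (S -` Z n \<inter> space P)"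
        using \<delta> by (intro mult_right_mono) auto
      finally have "exp (- \<delta>) * (\<Prod>i\<le>k. (?a i * r i) ^ n i / fact (n i) * exp (- (?a i * r i))) \<le>
          prob (S -` Z n \<inter> space P)"
        by (simp add: exp_minus field_simps)
      then show ?thesis
        unfolding N_Z emeasure_eq_measure
        by (subst ennreal_mult[symmetric]) (auto intro!: prod_nonneg mult_nonneg_nonneg ennreal_leI simp: r)
    qed
    have "AE w in P. \<forall>i. emeasure w (C i) = of_nat (cnt (C i) w)"
      using AE_emeasure_cnt[OF C(2,3)] by (simp add: AE_all_countable)
    then have "AE w in P. w \<in> G \<longrightarrow> w \<in> (\<Union>n\<in>J. Z n)"
      using AE_space
    proof eventually_elim
      case (elim w)
      define n where "n = restrict (\<lambda>i. cnt (C i) w) {..k}"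
      have w: "w \<in> Z n" using elim by (auto simp: Z_def n_def)
      have "Z n \<subseteq> G" if "w \<in> G"
      proof
        fix w' assume w': "w' \<in> Z n"
        show "w' \<in> G" using Gdet[of w w'] w w' that by (auto simp: Z_def)
      qed
      then have "n \<in> J" if "w \<in> G" using that by (auto simp: J_def n_def)
      then show ?case using w by blast
    qed
    then have "AE w in N. w \<in> G \<longrightarrow> w \<in> (\<Union>n\<in>J. Z n)"
      unfolding N_def by (subst AE_density) auto
    then have "emeasure N G \<le> emeasure N (\<Union>n\<in>J. Z n)"
      using J by (intro emeasure_mono_AE) (auto simp: sets_N)
    also have "\<dots> = (\<integral>\<^sup>+n. emeasure N (Z n) \<partial>count_space J)"
      by (rule emeasure_UN_countable[OF _ J disj]) (simp add: sets_N)
    finally have "ennreal (exp (- \<delta>)) * emeasure N G \<le>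
        (\<integral>\<^sup>+n. ennreal (exp (- \<delta>)) * emeasure N (Z n) \<partial>count_space J)"
      by (subst nn_integral_cmult) (auto intro: mult_left_mono)
    also have "\<dots> \<le> (\<integral>\<^sup>+n. emeasure P (S -` Z n \<inter> space P) \<partial>count_space J)"
      by (intro nn_integral_mono pt)
    also have "\<dots> = emeasure P (\<Union>n\<in>J. S -` Z n \<inter> space P)"
      by (rule emeasure_UN_countable[symmetric, OF _ J]) (use disj in \<open>auto simp: disjoint_family_on_def\<close>)
    also have "\<dots> \<le> emeasure P (S -` G \<inter> space P)"
      by (intro emeasure_mono) (auto simp: J_def)
    finally show ?thesis
      by (simp add: N.emeasure_eq_measure emeasure_eq_measure ennreal_mult[symmetric])
  qed
  have "ennreal (measure N E) = (\<integral>\<^sup>+w. ennreal (L w) * indicator E w \<partial>P)"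
    unfolding N.emeasure_eq_measure[symmetric] using E by (simp add: N_def emeasure_density)
  also have "\<dots> \<le> (\<integral>\<^sup>+w. ennreal \<mu> * indicator E w + ennreal (1 / \<mu>) * ennreal ((L w)\<^sup>2) \<partial>P)"
  proof (rule nn_integral_mono)
    fix w
    \<comment> \<open>Split at the level \<open>\<mu>\<close>: above it, \<open>L w\<close> is at
      most its square divided by \<open>\<mu>\<close>. With the second moment bounded, this gives an
      absolute continuity estimate that does not depend on \<open>k\<close> or on the cells.\<close>
    have "L w \<le> \<mu> + 1 / \<mu> * (L w)\<^sup>2"
    proof (cases "L w \<le> \<mu>")
      case True
      then show ?thesis using \<open>0 < \<mu>\<close> by (simp add: add_increasing2)
    next
      case False
      then have "\<mu> * L w \<le> L w * L w" using L0[of w] by (intro mult_right_mono) auto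
      then have "L w \<le> 1 / \<mu> * (L w)\<^sup>2" using \<open>0 < \<mu>\<close> by (simp add: field_simps power2_eq_square)
      then show ?thesis using \<open>0 < \<mu>\<close> by linarith
    qed
    then have "ennreal (L w) \<le> ennreal \<mu> + ennreal (1 / \<mu>) * ennreal ((L w)\<^sup>2)"
      using \<open>0 < \<mu>\<close> by (simp add: ennreal_mult[symmetric] ennreal_plus[symmetric] ennreal_leI del: ennreal_plus)
    then show "ennreal (L w) * indicator E w \<le> ennreal \<mu> * indicator E w + ennreal (1 / \<mu>) * ennreal ((L w)\<^sup>2)"
      by (auto split: split_indicator)
  qed
  also have "\<dots> = ennreal \<mu> * emeasure P E + ennreal (1 / \<mu>) * (\<integral>\<^sup>+w. ennreal ((L w)\<^sup>2) \<partial>P)"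
    using E by (subst nn_integral_add) (auto simp: nn_integral_cmult)
  also have "\<dots> \<le> ennreal \<mu> * ennreal (prob E) + ennreal (1 / \<mu>) * ennreal (exp V)"
    by (intro add_mono mult_left_mono int_L2) (auto simp: emeasure_eq_measure)
  also have "\<dots> = ennreal (\<mu> * prob E + exp V / \<mu>)"
    using \<open>0 < \<mu>\<close> by (simp add: ennreal_mult[symmetric] ennreal_plus[symmetric] del: ennreal_plus)
  finally have upper: "measure N E \<le> \<mu> * prob E + exp V / \<mu>"
    using \<open>0 < \<mu>\<close> by (subst (asm) ennreal_le_iff) auto
  have "exp (- \<delta>) * measure N (space P - E) \<le> prob (S -` (space P - E) \<inter> space P)"
  proof (rule lower)
    show "space P - E \<in> sets P" using E by (rule sets.compl_sets)
    show "w \<in> space P - E \<longleftrightarrow> w' \<in> space P - E"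
      if "w \<in> space P" "w' \<in> space P" "\<And>i. i \<le> k \<Longrightarrow> emeasure w (C i) = emeasure w' (C i)" for w w'
      using det[OF that] that(1,2) by blast
  qed
  also have "S -` (space P - E) \<inter> space P = space P - (S -` E \<inter> space P)"
    using measurable_space[OF S] by auto
  also have "prob \<dots> = 1 - prob (S -` E \<inter> space P)"
    by (rule prob_compl) (rule measurable_sets[OF S E])
  also have "measure N (space P - E) = 1 - measure N E"
    using N.prob_compl[of E] E by (simp add: N_def)
  finally have "prob (S -` E \<inter> space P) \<le> 1 - exp (- \<delta>) + exp (- \<delta>) * measure N E"
    by (simp add: algebra_simps)
  moreover have "1 - \<delta> \<le> exp (- \<delta>)" using exp_ge_add_one_self[of "- \<delta>"] by simp
  moreover have "0 \<le> \<delta>"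
    by (rule order_trans[OF _ \<delta>]) (auto intro!: sum_nonneg simp: le)
  then have "exp (- \<delta>) * measure N E \<le> 1 * measure N E" by (intro mult_right_mono) auto
  ultimately show ?thesis using upper unfolding S_def by linarith
qed


text \<open>The cylinder events. Phrasing them by determinacy instead of by preimages makes closure
  under complements and unions immediate.\<close>

definition finitary_events :: "'a measure set set" where
  "finitary_events = {E \<in> sets P. \<exists>\<C>. finite \<C> \<and> (\<forall>A\<in>\<C>. A \<in> sets M \<and> emeasure M A < \<infinity>) \<and>
    (\<forall>w\<in>space P. \<forall>w'\<in>space P. (\<forall>A\<in>\<C>. emeasure w A = emeasure w' A) \<longrightarrow> (w \<in> E \<longleftrightarrow> w' \<in> E))}"

text \<open>Cylinders use sets of finite intensity only. For generation, the count of an arbitrary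
  set is recovered as the countable sum of its counts on a disjoint cover by sets of finite
  measure.\<close>

lemma
  shows algebra_finitary_events: "algebra (space P) finitary_events"
    and sets_P_generated: "sets P = sigma_sets (space P) finitary_events"
proof -
  show "algebra (space P) finitary_events"
    unfolding algebra_iff_Un
  proof (intro conjI ballI)
    show "finitary_events \<subseteq> Pow (space P)" by (auto simp: finitary_events_def dest: sets.sets_into_space)
    show "{} \<in> finitary_events" by (auto simp: finitary_events_def intro!: exI[of _ "{}"])
    show "space P - E \<in> finitary_events" if "E \<in> finitary_events" for E
      using that unfolding finitary_events_def by auto
    show "E \<union> E' \<in> finitary_events" if E: "E \<in> finitary_events" "E' \<in> finitary_events" for E E'
    proof -
      obtain \<C> where \<C>: "finite \<C>" "\<forall>A\<in>\<C>. A \<in> sets M \<and> emeasure M A < \<infinity>"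
        "\<forall>w\<in>space P. \<forall>w'\<in>space P. (\<forall>A\<in>\<C>. emeasure w A = emeasure w' A) \<longrightarrow> (w \<in> E \<longleftrightarrow> w' \<in> E)"
        using E(1) unfolding finitary_events_def by auto
      obtain \<C>' where \<C>': "finite \<C>'" "\<forall>A\<in>\<C>'. A \<in> sets M \<and> emeasure M A < \<infinity>"
        "\<forall>w\<in>space P. \<forall>w'\<in>space P. (\<forall>A\<in>\<C>'. emeasure w A = emeasure w' A) \<longrightarrow> (w \<in> E' \<longleftrightarrow> w' \<in> E')"
        using E(2) unfolding finitary_events_def by auto
      have u: "E \<union> E' \<in> sets P" using E unfolding finitary_events_def by auto
      have "\<forall>w\<in>space P. \<forall>w'\<in>space P. (\<forall>A\<in>\<C> \<union> \<C>'. emeasure w A = emeasure w' A) \<longrightarrow>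
          (w \<in> E \<union> E' \<longleftrightarrow> w' \<in> E \<union> E')"
        using \<C>(3) \<C>'(3) by blast
      moreover have "finite (\<C> \<union> \<C>')" using \<C>(1) \<C>'(1) by simp
      moreover have "\<forall>A\<in>\<C> \<union> \<C>'. A \<in> sets M \<and> emeasure M A < \<infinity>" using \<C>(2) \<C>'(2) by blast
      ultimately show ?thesis unfolding finitary_events_def using u by blast
    qed
  qed
  let ?N = "sigma (space P) finitary_events"
  have finitary_Pow: "finitary_events \<subseteq> Pow (space P)" by (auto simp: finitary_events_def dest: sets.sets_into_space)
  have sp: "space ?N = space P" using finitary_Pow by (simp add: space_measure_of)
  have sets_N: "sets ?N = sigma_sets (space P) finitary_events" using finitary_Pow by (simp add: sets_measure_of)
  have fin: "(\<lambda>w. emeasure w A) \<in> borel_measurable ?N"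
    if A: "A \<in> sets M" "emeasure M A < \<infinity>" for A
  proof (rule measurableI)
    fix X :: "ennreal set" assume "X \<in> sets borel"
    then have "(\<lambda>w. emeasure w A) -` X \<inter> space P \<in> sets P" using A by measurable
    then have "(\<lambda>w. emeasure w A) -` X \<inter> space P \<in> finitary_events"
      using A unfolding finitary_events_def by (intro CollectI conjI exI[of _ "{A}"]) auto
    then show "(\<lambda>w. emeasure w A) -` X \<inter> space ?N \<in> sets ?N"
      unfolding sp sets_N by (rule sigma_sets.Basic)
  qed simp
  obtain X :: "nat \<Rightarrow> 'a set" where X: "range X \<subseteq> sets M" "(\<Union>i. X i) = space M"
      "\<And>i. emeasure M (X i) \<noteq> \<infinity>" "disjoint_family X"
    using M.sigma_finite_disjoint by metis
  have "(\<lambda>w. w) \<in> ?N \<rightarrow>\<^sub>M point_measures M"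
  proof (rule measurable_point_measures)
    fix A assume A: "A \<in> sets M"
    have "emeasure w A = (\<Sum>i. emeasure w (A \<inter> X i))" if w: "w \<in> space P" for w
    proof -
      have sw: "sets w = sets M" using w by (intro sets_point_measuresD) (simp add: space_P)
      have "(\<Sum>i. emeasure w (A \<inter> X i)) = emeasure w (\<Union>i. A \<inter> X i)"
      proof (rule suminf_emeasure)
        show "range (\<lambda>i. A \<inter> X i) \<subseteq> sets w" using A X(1) sw by auto
        show "disjoint_family (\<lambda>i. A \<inter> X i)"
          using X(4) unfolding disjoint_family_on_def by blast
      qed
      also have "(\<Union>i. A \<inter> X i) = A" using X(2) sets.sets_into_space[OF A] by auto
      finally show ?thesis ..
    qed
    moreover have "(\<lambda>w. \<Sum>i. emeasure w (A \<inter> X i)) \<in> borel_measurable ?N"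
    proof (intro borel_measurable_suminf_order fin)
      fix i
      have "emeasure M (A \<inter> X i) \<le> emeasure M (X i)" using X(1) by (intro emeasure_mono) auto
      then show "emeasure M (A \<inter> X i) < \<infinity>" using X(3)[of i] by (simp add: less_top le_less_trans)
    qed (use A X(1) in auto)
    ultimately show "(\<lambda>w. emeasure w A) \<in> borel_measurable ?N"
      by (subst measurable_cong) (auto simp: sp)
  qed (simp only: sp, simp only: space_P)
  then have "E \<in> sets ?N" if "E \<in> sets P" for E
  proof -
    have "(\<lambda>w. w) -` E \<inter> space ?N \<in> sets ?N"
      using \<open>(\<lambda>w. w) \<in> ?N \<rightarrow>\<^sub>M point_measures M\<close> that sets_P by (auto intro: measurable_sets)
    then show ?thesis using sets.sets_into_space[OF that] by (simp add: sp Int_absorb2)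
  qed
  moreover have "sigma_sets (space P) finitary_events \<subseteq> sets P"
    by (rule sets.sigma_sets_subset) (auto simp: finitary_events_def)
  ultimately show "sets P = sigma_sets (space P) finitary_events" unfolding sets_N by auto
qed

end

section \<open>Truncated intensities and null sets of the image law\<close>

lemma (in integrable_cocycle) sum_integral_disjoint_le:
  fixes g :: "'a \<Rightarrow> real" and C :: "nat \<Rightarrow> 'a set"
  assumes g: "integrable M g" "\<And>x. 0 \<le> g x" and C: "disjoint_family C" "\<And>i. C i \<in> sets M"
  shows "(\<Sum>i\<le>k. \<integral>x. g x * indicator (C i) x \<partial>M) \<le> (\<integral>x. g x \<partial>M)"
proof -
  have I: "integrable M (\<lambda>x. g x * indicator (C i) x)" for i
    using g C by (intro integrable_real_mult_indicator) auto
  have "(\<Sum>i\<le>k. \<integral>x. g x * indicator (C i) x \<partial>M) = (\<integral>x. (\<Sum>i\<le>k. g x * indicator (C i) x) \<partial>M)"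
    by (rule Bochner_Integration.integral_sum[symmetric]) (rule I)
  also have "\<dots> \<le> (\<integral>x. g x \<partial>M)"
  proof (rule integral_mono)
    fix x
    have "disjoint_family_on C {..k}" using C by (auto simp: disjoint_family_on_def)
    then have "(\<Sum>i\<le>k. indicator (C i) x) = (indicator (\<Union>i\<le>k. C i) x :: real)"
      by (intro indicator_UN_disjoint[symmetric]) auto
    then show "(\<Sum>i\<le>k. g x * indicator (C i) x) \<le> g x"
      using g(2)[of x] by (simp add: sum_distrib_left[symmetric] indicator_def)
    show "integrable M (\<lambda>x. \<Sum>i\<le>k. g x * indicator (C i) x)"
      by (rule Bochner_Integration.integrable_sum) (rule I)
  qed (rule g(1))
  finally show ?thesis .
qed

text \<open>\<open>r i\<close> is the mean of \<open>min (f x) K\<close> over \<open>C i\<close>.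
  The intensity lost is the integral of the excess of \<open>f\<close> over \<open>K\<close>. For
  the quadratic sum, one factor \<open>\<bar>r i - 1\<bar>\<close> is at most \<open>K\<close>, and
  the other, times the measure of \<open>C i\<close>, is at most the integral of
  \<open>\<bar>f x - 1\<bar>\<close> over \<open>C i\<close>. Both bounds are independent of the
  partition.\<close>

lemma (in integrable_cocycle) truncated_intensities:
  fixes C :: "nat \<Rightarrow> 'a set"
  assumes C: "disjoint_family C" "\<And>i. C i \<in> sets M" "\<And>i. emeasure M (C i) < \<infinity>" and K: "1 \<le> (K :: real)"
  shows "\<exists>r. (\<forall>i. 0 \<le> r i) \<and> (\<forall>i. measure M (C i) * r i \<le> measure M (T -` C i \<inter> space M)) \<and>
    (\<forall>k. (\<Sum>i\<le>k. measure M (T -` C i \<inter> space M) - measure M (C i) * r i) \<le> (\<integral>x. max 0 (f x - K) \<partial>M)) \<and>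
    (\<forall>k. (\<Sum>i\<le>k. measure M (C i) * (r i - 1)\<^sup>2) \<le> K * (\<integral>x. \<bar>f x - 1\<bar> \<partial>M))"
proof -
  let ?a = "\<lambda>i. measure M (C i)" and ?b = "\<lambda>i. measure M (T -` C i \<inter> space M)"
  have b: "?b i = (\<integral>x. f x * indicator (C i) x \<partial>M)"
    and fI: "integrable M (\<lambda>x. f x * indicator (C i) x)" for i
    using measure_funpow[OF C(2,3), of 1 i] F_integrable_on[OF C(2,3), of 1 i] by simp_all
  have aI: "integrable M (\<lambda>x. indicator (C i) x :: real)" for i using C by auto
  have mI: "integrable M (\<lambda>x. min (f x) K * indicator (C i) x)" for i
    by (rule Bochner_Integration.integrable_bound[OF fI[of i]])
      (use K f_nonneg C(2) in \<open>auto split: split_indicator\<close>)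
  define c where "c i = (\<integral>x. min (f x) K * indicator (C i) x \<partial>M)" for i
  \<comment> \<open>On a null cell the quotient is 0 by convention; \<open>c i\<close> vanishes
    there by \<open>cK\<close>, so \<open>cr\<close> still holds.\<close>
  define r where "r i = c i / ?a i" for i
  have c0: "0 \<le> c i" for i using K f_nonneg unfolding c_def by (intro Bochner_Integration.integral_nonneg) auto
  have cK: "c i \<le> K * ?a i" for i
  proof -
    have "c i \<le> (\<integral>x. K * indicator (C i) x \<partial>M)"
      unfolding c_def using aI K by (intro integral_mono mI) (auto split: split_indicator)
    then show ?thesis using C(2,3)[of i] by simp
  qed
  have cr: "?a i * r i = c i" for i
    using c0[of i] cK[of i] by (cases "?a i = 0") (auto simp: r_def)
  have r0: "0 \<le> r i" for i using c0 by (simp add: r_def)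
  have rK: "r i \<le> K" for i
    using cK[of i] K by (cases "?a i = 0") (auto simp: r_def field_simps zero_less_measure_iff)
  have bc: "?b i - c i = (\<integral>x. max 0 (f x - K) * indicator (C i) x \<partial>M)" for i
    unfolding b c_def
    by (subst Bochner_Integration.integral_diff[OF fI mI, symmetric])
      (intro Bochner_Integration.integral_cong, auto split: split_indicator)
  have maxI: "integrable M (\<lambda>x. max 0 (f x - K))"
    by (rule Bochner_Integration.integrable_bound[OF f_integrable]) (use K in auto)
  have ca: "\<bar>c i - ?a i\<bar> \<le> (\<integral>x. \<bar>f x - 1\<bar> * indicator (C i) x \<partial>M)" for i
  proof -
    have a: "?a i = (\<integral>x. indicator (C i) x \<partial>M)" using C(2,3)[of i] by simp
    have "c i - ?a i = (\<integral>x. min (f x) K * indicator (C i) x - indicator (C i) x \<partial>M)"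
      unfolding c_def a by (rule Bochner_Integration.integral_diff[OF mI aI, symmetric])
    also have "\<bar>\<dots>\<bar> \<le> (\<integral>x. \<bar>min (f x) K * indicator (C i) x - indicator (C i) x\<bar> \<partial>M)"
      by (rule integral_abs_bound)
    also have "\<dots> \<le> (\<integral>x. \<bar>f x - 1\<bar> * indicator (C i) x \<partial>M)"
      by (intro integral_mono integrable_abs Bochner_Integration.integrable_diff mI aI
          integrable_real_mult_indicator f_integrable C(2))
        (use K in \<open>auto split: split_indicator\<close>)
    finally show ?thesis .
  qed
  show ?thesis
  proof (intro exI[of _ r] conjI allI)
    show "0 \<le> r i" for i by (rule r0)
    show "?a i * r i \<le> ?b i" for i
    proof -
      have "0 \<le> ?b i - c i" unfolding bc by (intro Bochner_Integration.integral_nonneg) auto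
      then show ?thesis by (simp add: cr)
    qed
    show "(\<Sum>i\<le>k. ?b i - ?a i * r i) \<le> (\<integral>x. max 0 (f x - K) \<partial>M)" for k
      unfolding cr bc by (rule sum_integral_disjoint_le[OF maxI _ C(1,2)]) simp
    have "?a i * (r i - 1)\<^sup>2 \<le> K * (\<integral>x. \<bar>f x - 1\<bar> * indicator (C i) x \<partial>M)" for i
    proof -
      have "?a i * (r i - 1)\<^sup>2 = \<bar>r i - 1\<bar> * \<bar>?a i * (r i - 1)\<bar>"
        by (simp add: abs_mult power2_eq_square[symmetric] mult.left_commute)
      also have "?a i * (r i - 1) = c i - ?a i" using cr[of i] by (simp add: algebra_simps)
      also have "\<bar>r i - 1\<bar> * \<bar>c i - ?a i\<bar> \<le> K * (\<integral>x. \<bar>f x - 1\<bar> * indicator (C i) x \<partial>M)"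
        using r0[of i] rK[of i] K by (intro mult_mono ca) auto
      finally show ?thesis .
    qed
    then have "(\<Sum>i\<le>k. ?a i * (r i - 1)\<^sup>2) \<le> (\<Sum>i\<le>k. K * (\<integral>x. \<bar>f x - 1\<bar> * indicator (C i) x \<partial>M))" for k
      by (rule sum_mono)
    also have "(\<Sum>i\<le>k. K * (\<integral>x. \<bar>f x - 1\<bar> * indicator (C i) x \<partial>M)) \<le> K * (\<integral>x. \<bar>f x - 1\<bar> \<partial>M)" for k
      unfolding sum_distrib_left[symmetric] using K
      by (intro mult_left_mono sum_integral_disjoint_le[OF integrable_abs[OF f_integrable] _ C(1,2)]) auto
    finally show "(\<Sum>i\<le>k. ?a i * (r i - 1)\<^sup>2) \<le> K * (\<integral>x. \<bar>f x - 1\<bar> \<partial>M)" for k .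
  qed
qed

lemma (in integrable_cocycle) truncation_excess_tendsto_0:
  "(\<lambda>K. \<integral>x. max 0 (f x - real (Suc K)) \<partial>M) \<longlonglongrightarrow> 0"
proof -
  have "(\<lambda>K. \<integral>x. max 0 (f x - real (Suc K)) \<partial>M) \<longlonglongrightarrow> (\<integral>x. 0 \<partial>M)"
  proof (rule integral_dominated_convergence[where w = "\<lambda>x. \<bar>f x - 1\<bar>"])
    show "AE x in M. (\<lambda>K. max 0 (f x - real (Suc K))) \<longlonglongrightarrow> 0"
    proof (rule AE_I2, rule tendsto_eventually)
      fix x
      obtain k where "f x \<le> real k" using real_arch_simple by blast
      then show "eventually (\<lambda>K. max 0 (f x - real (Suc K)) = 0) sequentially"
        by (intro eventually_sequentiallyI[of k]) auto
    qed
  qed (use f_integrable in auto)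
  then show ?thesis by simp
qed

text \<open>A null event is close to a finitary event \<open>A\<close> under both \<open>P\<close>
  and the image law \<open>Q\<close>. Then \<open>prob A\<close> is small, and the uniform estimate
  on finitary events makes \<open>measure Q A\<close> small too.\<close>

lemma (in integrable_cocycle) suspension_null:
  assumes "poisson_process M P" and E: "E \<in> null_sets P"
  shows "suspension M T -` E \<inter> space P \<in> null_sets P"
proof -
  interpret poisson_process M P by fact
  define S where "S = suspension M T"
  have S [measurable]: "S \<in> P \<rightarrow>\<^sub>M P" unfolding S_def by (rule suspension_measurable[OF T])
  have [measurable]: "E \<in> sets P" using E by auto
  define Q where "Q = distr P P S"
  interpret Q: prob_space Q unfolding Q_def by (rule prob_space_distr) measurable
  have Q: "measure Q A = prob (S -` A \<inter> space P)" if "A \<in> sets P" for A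
    using that by (simp add: Q_def measure_distr)
  have sets_Q: "sets Q = sets P" by (simp add: Q_def)
  \<comment> \<open>The constants are chosen in turn: the truncation level with excess below
    \<open>t / 4\<close>, then \<open>\<mu>\<close> with \<open>exp V / \<mu> = t / 4\<close>, then
    \<open>\<eta>\<close> with \<open>(\<mu> + 1) * \<eta> = t / 4\<close>. The form
    \<open>0 + t\<close> is the one \<open>field_le_epsilon\<close> expects.\<close>
  have "measure Q E \<le> 0 + t" if t: "0 < t" for t
  proof -
    have "eventually (\<lambda>K. (\<integral>x. max 0 (f x - real (Suc K)) \<partial>M) < t / 4) sequentially"
      using t by (intro order_tendstoD[OF truncation_excess_tendsto_0]) auto
    then obtain k where k: "(\<integral>x. max 0 (f x - real (Suc k)) \<partial>M) < t / 4"
      by (auto simp: eventually_sequentially)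
    define V where "V = real (Suc k) * (\<integral>x. \<bar>f x - 1\<bar> \<partial>M)"
    define \<mu> where "\<mu> = 4 * exp V / t"
    have \<mu>: "\<mu> > 0" "exp V / \<mu> = t / 4" using t by (auto simp: \<mu>_def)
    define \<eta> where "\<eta> = t / (4 * (\<mu> + 1))"
    have \<eta>: "\<eta> > 0" using t \<mu> by (simp add: \<eta>_def)
    have "E \<in> sigma_sets (space P) finitary_events"
      using \<open>E \<in> sets P\<close> unfolding sets_P_generated .
    then have "\<exists>A\<in>finitary_events. prob ((E - A) \<union> (A - E)) + measure Q ((E - A) \<union> (A - E)) < \<eta>"
      by (rule measure_symdiff_approx[OF algebra_finitary_events finite_measure_axioms
          Q.finite_measure_axioms sets_P_generated sets_Q[unfolded sets_P_generated] _ \<eta>])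
    then obtain A where A0: "A \<in> finitary_events"
      and near: "prob ((E - A) \<union> (A - E)) + measure Q ((E - A) \<union> (A - E)) < \<eta>"
      by blast
    from A0 obtain \<C> where A: "A \<in> sets P" "finite \<C>" "\<forall>A\<in>\<C>. A \<in> sets M \<and> emeasure M A < \<infinity>"
      "\<forall>w\<in>space P. \<forall>w'\<in>space P. (\<forall>B\<in>\<C>. emeasure w B = emeasure w' B) \<longrightarrow> (w \<in> A \<longleftrightarrow> w' \<in> A)"
      unfolding finitary_events_def by blast
    note [measurable] = A(1)
    obtain C :: "nat \<Rightarrow> 'a set" and m where C: "disjoint_family C"
        "\<And>i. C i \<in> sets M" "\<And>i. emeasure M (C i) < \<infinity>"
        and ref: "\<And>B. B \<in> \<C> \<Longrightarrow> \<exists>J\<subseteq>{..m}. B = (\<Union>i\<in>J. C i)"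
      using finite_disjoint_refinement[of \<C> M] A(2,3) by metis
    have K: "1 \<le> real (Suc k)" by simp
    obtain r where r: "\<And>i. 0 \<le> r i" "\<And>i. measure M (C i) * r i \<le> measure M (T -` C i \<inter> space M)"
      "\<And>m. (\<Sum>i\<le>m. measure M (T -` C i \<inter> space M) - measure M (C i) * r i) \<le> (\<integral>x. max 0 (f x - real (Suc k)) \<partial>M)"
      "\<And>m. (\<Sum>i\<le>m. measure M (C i) * (r i - 1)\<^sup>2) \<le> V"
      using truncated_intensities[OF C K, folded V_def] by blast
    have "prob (S -` A \<inter> space P) \<le> (\<integral>x. max 0 (f x - real (Suc k)) \<partial>M) + \<mu> * prob A + exp V / \<mu>"
      unfolding S_def
    proof (rule suspension_prob_le[OF T C _ r A(1) _ \<mu>(1)])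
      show "emeasure M (T -` C i \<inter> space M) < \<infinity>" for i
        using emeasure_funpow[OF C(2,3), of 1 i] by simp
      fix w w' assume w: "w \<in> space P" "w' \<in> space P"
        and eq: "\<And>i. i \<le> m \<Longrightarrow> emeasure w (C i) = emeasure w' (C i)"
      have "emeasure w B = emeasure w' B" if "B \<in> \<C>" for B
      proof -
        obtain J where J: "J \<subseteq> {..m}" "B = (\<Union>i\<in>J. C i)" using ref \<open>B \<in> \<C>\<close> by blast
        then have "finite J" "disjoint_family_on C J"
          using C(1) by (auto intro: finite_subset simp: disjoint_family_on_def)
        then have sum: "(\<Sum>i\<in>J. emeasure v (C i)) = emeasure v B" if "v \<in> space P" for v
          using sets_point_measuresD[of v M] that C(2) unfolding J(2)
          by (intro sum_emeasure) (auto simp: space_P)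
        have "(\<Sum>i\<in>J. emeasure w (C i)) = (\<Sum>i\<in>J. emeasure w' (C i))"
          using J(1) eq by (intro sum.cong) auto
        then show ?thesis unfolding sum[OF w(1)] sum[OF w(2)] .
      qed
      then show "w \<in> A \<longleftrightarrow> w' \<in> A" using A(4) w by blast
    qed
    then have QA: "measure Q A \<le> t / 2 + \<mu> * prob A" using k \<mu>(2) A(1) by (simp add: Q)
    have "prob A \<le> prob (((E - A) \<union> (A - E)) \<union> E)" by (intro finite_measure_mono) auto
    also have "\<dots> \<le> prob ((E - A) \<union> (A - E)) + prob E" by (rule measure_Un_le) auto
    also have "prob E = 0" using E by (simp add: null_sets_def measure_def)
    finally have PA: "prob A \<le> \<eta>" using near measure_nonneg[of Q "(E - A) \<union> (A - E)"] by linarith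
    have "measure Q E \<le> measure Q (((E - A) \<union> (A - E)) \<union> A)"
      by (intro Q.finite_measure_mono) (auto simp: sets_Q)
    also have "\<dots> \<le> measure Q ((E - A) \<union> (A - E)) + measure Q A"
      by (rule measure_Un_le) (auto simp: sets_Q)
    also have "\<dots> \<le> \<eta> + (t / 2 + \<mu> * \<eta>)"
      using near QA mult_left_mono[OF PA, of \<mu>] \<mu>(1) measure_nonneg[of P "(E - A) \<union> (A - E)"] by linarith
    also have "\<dots> = t / 2 + (\<mu> + 1) * \<eta>" by (simp add: algebra_simps)
    also have "(\<mu> + 1) * \<eta> = t / 4" using \<mu>(1) by (simp add: \<eta>_def divide_simps)
    finally show ?thesis using t by simp
  qed
  then have "measure Q E \<le> 0" by (rule field_le_epsilon)
  then have "prob (S -` E \<inter> space P) = 0" using Q[of E] by (simp add: measure_le_0_iff)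
  then show ?thesis unfolding S_def[symmetric] by (simp add: null_sets_def emeasure_eq_measure)
qed

section \<open>Total dissipativity\<close>

text \<open>Integrability holds because transporting \<open>1 / f (T x) - 1\<close> by
  \<open>T\<close> and multiplying by the density \<open>f\<close> leaves \<open>1 - f\<close>. The
  instance supplies the converse half of nonsingularity of the suspension.\<close>

lemma (in integrable_cocycle) integrable_cocycle_inverse:
  assumes pos: "AE x in M. 0 < f x"
  shows "integrable_cocycle M R T (\<lambda>x. 1 / f (T x))"
proof
  have TR: "AE x in M. T (R x) = x" using inverse by (auto simp: inverse_mod0_def)
  show "inverse_mod0 M R T" using inverse T by (auto simp: inverse_mod0_def)
  show "distr M M R = density M (\<lambda>x. ennreal (1 / f (T x)))"
  proof (rule measure_eqI)
    fix A assume "A \<in> sets (distr M M R)"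
    then have A [measurable]: "A \<in> sets M" by simp
    have "emeasure (density M (\<lambda>x. ennreal (1 / f (T x)))) A =
        (\<integral>\<^sup>+x. indicator A x * ennreal (1 / f (T x)) \<partial>M)"
      by (subst emeasure_density) (auto simp: mult.commute)
    also have "\<dots> = (\<integral>\<^sup>+y. ennreal (f y) * (indicator A (R y) * ennreal (1 / f y)) \<partial>M)"
      by (rule nn_integral_transfer[symmetric]) auto
    also have "\<dots> = (\<integral>\<^sup>+y. indicator A (R y) \<partial>M)"
    proof (rule nn_integral_cong_AE, use pos in eventually_elim)
      fix y assume "0 < f y"
      then have "ennreal (f y) * ennreal (1 / f y) = 1" by (simp add: ennreal_mult[symmetric])
      then show "ennreal (f y) * (indicator A (R y) * ennreal (1 / f y)) = indicator A (R y)"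
        by (simp add: indicator_def)
    qed
    also have "\<dots> = emeasure (distr M M R) A"
      by (subst nn_integral_distr[symmetric, of R M M]) auto
    finally show "emeasure (distr M M R) A = emeasure (density M (\<lambda>x. ennreal (1 / f (T x)))) A" ..
  qed simp
  have "integrable (distr M M T) (\<lambda>y. 1 / f y - 1)"
  proof -
    have "AE y in M. f y * (1 / f y - 1) = 1 - f y"
      using pos by eventually_elim (simp add: field_simps)
    moreover have "integrable M (\<lambda>y. 1 - f y)"
      using integrable_minus[OF f_integrable] by simp
    ultimately have "integrable M (\<lambda>y. f y * (1 / f y - 1))"
      by (subst integrable_cong_AE[where g = "\<lambda>y. 1 - f y"]) auto
    then show ?thesis
      unfolding distr_T by (subst integrable_density) (auto simp: f_nonneg)
  qed
  then show "integrable M (\<lambda>x. 1 / f (T x) - 1)" by (subst (asm) integrable_distr_eq) auto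
qed (auto simp: f_nonneg)

text \<open>The exceptional set of an identity modulo \<open>M\<close> is contained in a null set
  \<open>Z\<close>, and a Poisson configuration almost surely has no point in \<open>Z\<close>. So
  the identity holds almost everywhere for almost every configuration \<open>w\<close>, which
  suffices for image measures.\<close>

lemma (in poisson_process) inverse_mod0_suspension:
  assumes T: "T \<in> M \<rightarrow>\<^sub>M M" and inv: "inverse_mod0 M T R"
  shows "inverse_mod0 P (suspension M T) (suspension M R)"
proof -
  have comp_id: "AE w in P. suspension M U (suspension M W w) = w"
    if U: "U \<in> M \<rightarrow>\<^sub>M M" and W: "W \<in> M \<rightarrow>\<^sub>M M" and UW: "AE x in M. U (W x) = x" for U W
  proof -
    obtain Z where Z: "Z \<in> null_sets M" "{x \<in> space M. U (W x) \<noteq> x} \<subseteq> Z"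
      using UW by (auto simp: eventually_ae_filter)
    have "prob {w \<in> space P. emeasure w Z = of_nat 0} = 1"
      using Z(1) by (subst prob_eq) (auto simp: null_sets_def measure_def)
    then have "AE w in P. emeasure w Z = 0"
      using Z(1) by (subst (asm) prob_Collect_eq_1) auto
    then show ?thesis
      using AE_space
    proof eventually_elim
      case (elim w)
      have w: "w \<in> space (point_measures M)" using elim(2) by (simp add: space_P)
      note sets_w [measurable_cong] = sets_point_measuresD[OF w]
      have Zw: "Z \<in> null_sets w" using elim(1) Z(1) by (auto simp: null_sets_def sets_w)
      have ae: "AE x in w. U (W x) = x"
        by (rule AE_I'[OF Zw]) (use Z(2) space_point_measuresD[OF w] in auto)
      have "suspension M U (suspension M W w) = distr w M (\<lambda>x. U (W x))"
        unfolding suspension_def using U W by (subst distr_distr) (auto simp: comp_def)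
      also have "\<dots> = distr w M (\<lambda>x. x)"
        by (rule distr_cong_AE) (use ae U W in auto)
      also have "\<dots> = w" using sets_w by (intro distr_id2) auto
      finally show ?case .
    qed
  qed
  show ?thesis
    using inv comp_id T suspension_measurable[of R] by (auto simp: inverse_mod0_def)
qed

theorem theoremE:
  fixes M :: "'a measure" and P :: "'a measure measure" and T :: "'a \<Rightarrow> 'a"
  assumes "standard_borel M" and "sigma_finite_measure M" and "non_atomic M"
    and "emeasure M (space M) = \<infinity>"
    and "poisson_law M P"
    and "T \<in> Aut1 M" and "chi M T \<noteq> 0"
  shows "totally_dissipative P (suspension M T)"
proof -
  define f where "f = nonsing_deriv M T"
  obtain R where T: "T \<in> M \<rightarrow>\<^sub>M M" and inv: "inverse_mod0 M T R"
    and null: "null_sets (distr M M T) = null_sets M"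
    using \<open>T \<in> Aut1 M\<close> by (auto simp: Aut1_def Aut_def)
  have distr_T: "distr M M T = density M (\<lambda>x. ennreal (f x))"
    unfolding f_def by (rule Aut1_density) fact+
  have f_meas [measurable]: "f \<in> borel_measurable M"
    unfolding f_def nonsing_deriv_def by measurable
  interpret integrable_cocycle M T R f
    using T inv distr_T \<open>T \<in> Aut1 M\<close> f_meas
    by unfold_locales (auto simp: f_def nonsing_deriv_def Aut1_def)
  interpret poisson_process M P
    using assms by (auto simp: poisson_process_def poisson_process_axioms_def)
  \<comment> \<open>The zero set of a density is null for the measure it defines; nonsingularity
    makes it null for \<open>M\<close>.\<close>
  have "{x \<in> space M. f x = 0} \<in> null_sets (density M (\<lambda>x. ennreal (f x)))"
    by (subst null_sets_density_iff) auto
  then have "{x \<in> space M. f x = 0} \<in> null_sets M" using null distr_T by simp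
  then have pos: "AE x in M. 0 < f x"
    by (rule AE_I') (use f_nonneg in \<open>auto simp: less_le\<close>)
  interpret inv': integrable_cocycle M R T "\<lambda>x. 1 / f (T x)"
    by (rule integrable_cocycle_inverse[OF pos])
  define S where "S = suspension M T"
  have S [measurable]: "S \<in> P \<rightarrow>\<^sub>M P" unfolding S_def by (rule suspension_measurable[OF T])
  have S_inv: "inverse_mod0 P S (suspension M R)"
    unfolding S_def by (rule inverse_mod0_suspension[OF T inv])
  have S_null: "null_sets (distr P P S) = null_sets P"
  proof (intro equalityI subsetI)
    fix E assume "E \<in> null_sets P"
    then show "E \<in> null_sets (distr P P S)"
      using suspension_null[OF poisson_process_axioms, of E]
      by (auto simp: null_sets_distr_iff S S_def[symmetric])
  next
    fix E assume "E \<in> null_sets (distr P P S)"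
    then have E: "E \<in> sets P" "S -` E \<inter> space P \<in> null_sets P" by (auto simp: null_sets_distr_iff S)
    \<comment> \<open>The suspension of \<open>R\<close> also pulls null sets back to null sets.
      Applied to the preimage of \<open>E\<close> under \<open>S\<close>, it gives \<open>E\<close>
      back up to a null set.\<close>
    have "AE w in P. suspension M R w \<notin> S -` E \<inter> space P"
      using inv'.suspension_null[OF poisson_process_axioms E(2)] by (auto dest!: AE_not_in)
    moreover have "AE w in P. S (suspension M R w) = w" using S_inv by (auto simp: inverse_mod0_def)
    ultimately have "AE w in P. w \<notin> E"
      using AE_space by eventually_elim (use suspension_in_space[OF inv'.T] in \<open>auto simp: space_P\<close>)
    then show "E \<in> null_sets P" using E(1) by (simp add: AE_iff_null_sets)
  qed
  have "(\<integral>x. f x - 1 \<partial>M) \<noteq> 0" using \<open>chi M T \<noteq> 0\<close> by (simp add: chi_def f_def)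
  then obtain e c where ec: "0 < e" "0 < c" and gap: "\<And>n. \<exists>D\<in>sets M. emeasure M D < \<infinity> \<and>
      ((1 + e) * measure M D + c * real n \<le> measure M ((T ^^ n) -` D \<inter> space M) \<or>
       (1 + e) * measure M ((T ^^ n) -` D \<inter> space M) + c * real n \<le> measure M D)"
    using linear_gap by metis
  define q where "q = exp (- (e / (2 * (1 + e))) * c)"
  have q: "0 < q" "q < 1" using ec by (auto simp: q_def)
  have qn: "exp (- (e / (2 * (1 + e))) * (c * real n)) = q ^ n" for n
    unfolding q_def by (subst exp_of_nat_mult[symmetric]) (simp add: ac_simps)
  have "\<exists>A\<in>sets P. prob (space P - A) \<le> q ^ n \<and> prob ((S ^^ n) -` A \<inter> space P) \<le> q ^ n" for n
  proof -
    obtain D where D: "D \<in> sets M" "emeasure M D < \<infinity>"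
      and g: "(1 + e) * measure M D + c * real n \<le> measure M ((T ^^ n) -` D \<inter> space M) \<or>
       (1 + e) * measure M ((T ^^ n) -` D \<inter> space M) + c * real n \<le> measure M D"
      using gap by blast
    define D' where "D' = (T ^^ n) -` D \<inter> space M"
    have Tn: "T ^^ n \<in> M \<rightarrow>\<^sub>M M" by (rule measurable_funpow[OF T])
    have D': "D' \<in> sets M" "emeasure M D' < \<infinity>"
      using D Tn emeasure_funpow[OF D, of n] by (auto simp: D'_def)
    have cnt_S: "cnt D ((S ^^ n) w) = cnt D' w" if "w \<in> space P" for w
      using that D Tn unfolding S_def
      by (simp add: suspension_funpow[OF T] cnt_suspension D'_def space_P)
    have sp: "(S ^^ n) w \<in> space P" if "w \<in> space P" for w
      using measurable_space[OF measurable_funpow[OF S] that] .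
    note [measurable] = D(1)
    from g show ?thesis
    proof
      assume "(1 + e) * measure M D + c * real n \<le> measure M ((T ^^ n) -` D \<inter> space M)"
      then have "(1 + e) * measure M D + c * real n \<le> measure M D'" by (simp only: D'_def)
      from prob_cnt_separation[OF D D' ec(1) this] obtain s
        where s: "prob {w \<in> space P. s \<le> real (cnt D w)} \<le> q ^ n"
          "prob {w \<in> space P. real (cnt D' w) < s} \<le> q ^ n"
        unfolding qn .
      \<comment> \<open>The count of \<open>D\<close> after \<open>n\<close> steps is the present
        count of \<open>D'\<close>, which is typically the larger one here. So having few points in
        \<open>D\<close> is likely under \<open>P\<close> and unlikely under its image by
        \<open>S ^^ n\<close>.\<close>
      let ?A = "{w \<in> space P. real (cnt D w) < s}"
      have "space P - ?A = {w \<in> space P. s \<le> real (cnt D w)}" by auto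
      moreover have "(S ^^ n) -` ?A \<inter> space P = {w \<in> space P. real (cnt D' w) < s}"
        using cnt_S sp by auto
      ultimately show ?thesis using s by (intro bexI[of _ ?A]) auto
    next
      assume "(1 + e) * measure M ((T ^^ n) -` D \<inter> space M) + c * real n \<le> measure M D"
      then have "(1 + e) * measure M D' + c * real n \<le> measure M D" by (simp only: D'_def)
      from prob_cnt_separation[OF D' D ec(1) this] obtain s
        where s: "prob {w \<in> space P. s \<le> real (cnt D' w)} \<le> q ^ n"
          "prob {w \<in> space P. real (cnt D w) < s} \<le> q ^ n"
        unfolding qn .
      \<comment> \<open>With the roles reversed, having many points in \<open>D\<close> is the
        likely event.\<close>
      let ?A = "{w \<in> space P. s \<le> real (cnt D w)}"
      have "space P - ?A = {w \<in> space P. real (cnt D w) < s}" by auto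
      moreover have "(S ^^ n) -` ?A \<inter> space P = {w \<in> space P. s \<le> real (cnt D' w)}"
        using cnt_S sp by auto
      ultimately show ?thesis using s by (intro bexI[of _ ?A]) auto
    qed
  qed
  then obtain A where A: "\<And>n. A n \<in> sets P" "\<And>n. prob (space P - A n) \<le> q ^ n"
      "\<And>n. prob ((S ^^ n) -` A n \<inter> space P) \<le> q ^ n"
    by metis
  have q_sum: "summable (\<lambda>n. q ^ n)" using q by (intro summable_geometric) auto
  have "totally_dissipative P S"
  proof (rule totally_dissipativeI[OF finite_measure_axioms S S_inv S_null A(1)])
    show "summable (\<lambda>n. prob (space P - A n))"
      by (rule summable_comparison_test[OF _ q_sum]) (use A(2) in auto)
    show "summable (\<lambda>n. prob ((S ^^ n) -` A n \<inter> space P))"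
      by (rule summable_comparison_test[OF _ q_sum]) (use A(3) in auto)
  qed
  then show ?thesis unfolding S_def .
qed

end
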